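(* Let $\mathsf{A}\subset GL_2(\mathbb{R})$ and let $\mathcal{S}(\mathsf{A})$ be the sub-semigroup of $GL_2(\mathbb{R})$ generated by $\mathsf{A}$. If $\mathcal{S}(\mathsf{A})$ is almost multiplicative, then exactly one of the two following conditions holds: (1) $\mathsf{A}$ is strongly conformal; (2) $\mathsf{A}$ has an invariant unstable multicone and $\mathcal{S}(\mathsf{A})$ does not contain parabolic elements.
   Context: $\|\cdot\|$ denotes the operator norm. $\mathcal{S}(\mathsf{A})=\{A_1\cdots A_n : n\in\mathbb{N},\ A_i\in\mathsf{A}\}$. A semigroup $\mathcal{S}\subset GL_2(\mathbb{R})$ is almost multiplicative if there is $\kappa>0$ with $\|AB\|\ge\kappa\|A\|\|B\|$ for all $A,B\in\mathcal{S}$. A matrix is proximal if it has two real eigenvalues with distinct absolute values; parabolic if it has only one eigenspace (the single eigenvalue has geometric multiplicity one); conformal if its two eigenvalues have the same absolute value, equivalently there is an invertible $M$ with $|\det A|^{-1/2}MAM^{-1}\in O(2)$. A set $\mathsf{A}\subset GL_2(\mathbb{R})$ is strongly conformal if there is a single invertible $M$ with $|\det A|^{-1/2}MAM^{-1}\in O(2)$ for all $A\in\mathsf{A}$. $\mathbb{RP}^1$ is the real projective line (lines through the origin in $\mathbb{R}^2$), on which $GL_2(\mathbb{R})$ acts. A multicone is a proper subset of $\mathbb{RP}^1$ that is a finite union of closed projective intervals; it is invariant for $\mathsf{A}$ if $A\mathcal{C}\subset\mathcal{C}$ for all $A\in\mathsf{A}$. For a proximal $A$, $u(A)$ and $s(A)$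 denote the eigenspaces of the eigenvalues of largest and smallest absolute value. $X_u(\mathsf{A})=\overline{\{u(A):A\in\mathcal{S}(\mathsf{A})\text{ proximal}\}}$, $X_s(\mathsf{A})=\overline{\{s(A):A\in\mathcal{S}(\mathsf{A})\text{ proximal}\}}$. A multicone $\mathcal{C}$ is an unstable multicone for $\mathsf{A}$ if $\mathcal{S}(\mathsf{A})$ contains at least one proximal element and: $\mathcal{C}\cap X_s(\mathsf{A})=\emptyset$; $\partial\mathcal{C}\cap X_u(\mathsf{A})=\emptyset$; each connected component of $\mathcal{C}$ intersects $X_u(\mathsf{A})$. *)

theory Defs
  imports "HOL-Analysis.Analysis"
begin

type_synonym mat2 = "real^2^2"
type_synonym vec2 = "real^2"

text \<open>Operator norm of a 2x2 matrix (Euclidean norm on R^2).\<close>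
definition opnorm :: "mat2 \<Rightarrow> real" where
  "opnorm A = onorm (\<lambda>x. A *v x)"

text \<open>The semigroup generated by a set of matrices: all finite nonempty products.\<close>
definition gen_semigroup :: "mat2 set \<Rightarrow> mat2 set" where
  "gen_semigroup AA = {foldr (**) xs (mat 1) | xs. xs \<noteq> [] \<and> set xs \<subseteq> AA}"

definition almost_multiplicative :: "mat2 set \<Rightarrow> bool" where
  "almost_multiplicative S \<longleftrightarrow>
     (\<exists>\<kappa>>0. \<forall>A\<in>S. \<forall>B\<in>S. opnorm (A ** B) \<ge> \<kappa> * opnorm A * opnorm B)"

text \<open>Real eigenvalues and eigenspaces.\<close>
definition real_eigenvalue :: "mat2 \<Rightarrow> real \<Rightarrow> bool" where
  "real_eigenvalue A l \<longleftrightarrow> (\<exists>v. v \<noteq> 0 \<and> A *v v = l *\<^sub>R v)"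

definition eigenspace :: "mat2 \<Rightarrow> real \<Rightarrow> vec2 set" where
  "eigenspace A l = {v. A *v v = l *\<^sub>R v}"

definition proximal :: "mat2 \<Rightarrow> bool" where
  "proximal A \<longleftrightarrow> (\<exists>l m. real_eigenvalue A l \<and> real_eigenvalue A m \<and> \<bar>l\<bar> \<noteq> \<bar>m\<bar>)"

text \<open>Parabolic: only one eigenspace, i.e. a single (real) eigenvalue of geometric multiplicity one.\<close>
definition parabolic :: "mat2 \<Rightarrow> bool" where
  "parabolic A \<longleftrightarrow> (\<exists>l. real_eigenvalue A l \<and> (\<forall>m. real_eigenvalue A m \<longrightarrow> m = l)
                         \<and> dim (eigenspace A l) = 1)"

text \<open>Strong conformality (O(2) = orthogonal matrices).\<close>
definition strongly_conformal :: "mat2 set \<Rightarrow> bool" where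
  "strongly_conformal AA \<longleftrightarrow>
     (\<exists>M::mat2. invertible M \<and>
        (\<forall>A\<in>AA. orthogonal_matrix ((\<bar>det A\<bar> powr (-1/2)) *\<^sub>R (M ** A ** matrix_inv M))))"

text \<open>The real projective line: lines through the origin, i.e. 1-dimensional subspaces.\<close>
definition RP1 :: "vec2 set set" where
  "RP1 = {L. subspace L \<and> dim L = 1}"

text \<open>The line of angle theta; theta \<mapsto> line theta is the standard quotient map R \<rightarrow> RP^1.\<close>
definition line_of_angle :: "real \<Rightarrow> vec2 set" where
  "line_of_angle \<theta> = span {vector [cos \<theta>, sin \<theta>]}"

text \<open>Standard topology on RP^1: quotient topology induced by the angle map.\<close>
definition RP1_top :: "vec2 set topology" where
  "RP1_top = topology (\<lambda>U. U \<subseteq> RP1 \<and> open (line_of_angle -` U))"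

text \<open>Action of a matrix on RP^1.\<close>
definition act :: "mat2 \<Rightarrow> vec2 set \<Rightarrow> vec2 set" where
  "act A L = (\<lambda>v. A *v v) ` L"

text \<open>Closed projective interval (proper, possibly a single point).\<close>
definition closed_proj_interval :: "vec2 set set \<Rightarrow> bool" where
  "closed_proj_interval I \<longleftrightarrow>
     (\<exists>a b. a \<le> b \<and> b < a + pi \<and> I = line_of_angle ` {a..b})"

text \<open>Multicone: nonempty proper subset of RP^1 that is a finite union of closed intervals.\<close>
definition multicone :: "vec2 set set \<Rightarrow> bool" where
  "multicone C \<longleftrightarrow> C \<subseteq> RP1 \<and> C \<noteq> RP1 \<and> C \<noteq> {} \<and>
     (\<exists>F. finite F \<and> (\<forall>I\<in>F. closed_proj_interval I) \<and> C = \<Union>F)"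

definition invariant_multicone :: "mat2 set \<Rightarrow> vec2 set set \<Rightarrow> bool" where
  "invariant_multicone AA C \<longleftrightarrow> multicone C \<and> (\<forall>A\<in>AA. act A ` C \<subseteq> C)"

text \<open>Eigenspaces of the eigenvalues of largest / smallest absolute value.\<close>
definition u_space :: "mat2 \<Rightarrow> vec2 set" where
  "u_space A = {v. \<exists>l. A *v v = l *\<^sub>R v \<and> (\<forall>m. real_eigenvalue A m \<longrightarrow> \<bar>m\<bar> \<le> \<bar>l\<bar>)}"

definition s_space :: "mat2 \<Rightarrow> vec2 set" where
  "s_space A = {v. \<exists>l. A *v v = l *\<^sub>R v \<and> (\<forall>m. real_eigenvalue A m \<longrightarrow> \<bar>l\<bar> \<le> \<bar>m\<bar>)}"

definition X_u :: "mat2 set \<Rightarrow> vec2 set set" where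
  "X_u AA = RP1_top closure_of {u_space A | A. A \<in> gen_semigroup AA \<and> proximal A}"

definition X_s :: "mat2 set \<Rightarrow> vec2 set set" where
  "X_s AA = RP1_top closure_of {s_space A | A. A \<in> gen_semigroup AA \<and> proximal A}"

definition unstable_multicone :: "mat2 set \<Rightarrow> vec2 set set \<Rightarrow> bool" where
  "unstable_multicone AA C \<longleftrightarrow> multicone C \<and>
     (\<exists>A\<in>gen_semigroup AA. proximal A) \<and>
     C \<inter> X_s AA = {} \<and>
     (RP1_top frontier_of C) \<inter> X_u AA = {} \<and>
     (\<forall>K\<in>connected_components_of (subtopology RP1_top C). K \<inter> X_u AA \<noteq> {})"

end

theory Submission
  imports Defs
begin

text \<open>
  Let \<open>T\<close> be the closure of the cone over the semigroup \<open>S\<close>. Almost multiplicativity passes to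
  \<open>T\<close>, so no element of \<open>T\<close> is nonzero and nilpotent; this excludes parabolic elements of \<open>S\<close>.

  If \<open>S\<close> has no proximal element, the Cayley--Hamilton identity bounds \<open>S\<close> after normalising
  determinants, and a bounded semigroup preserves an inner product.

  If \<open>S\<close> has a proximal element, then the range of every rank one element of \<open>T\<close> lies in \<open>X_u\<close>. Let
  \<open>N(\<epsilon>)\<close> be the set of \<open>x\<close> with \<open>\<epsilon> \<parallel>B\<parallel> \<parallel>x\<parallel> \<le> \<parallel>B x\<parallel>\<close> for all \<open>B \<in> T\<close>. It misses \<open>X_s\<close>, it contains
  \<open>X_u\<close> for \<open>\<epsilon> = \<kappa>\<close> and a neighbourhood of \<open>X_u\<close> for \<open>\<epsilon> = \<kappa>/2\<close>, and \<open>T\<close> maps \<open>N(\<epsilon>)\<close> into \<open>N(\<kappa>\<epsilon>)\<close>.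
  So the largest invariant subset of \<open>N(\<kappa>\<^sup>2/2)\<close> is a closed invariant set that contains a
  neighbourhood of \<open>X_u\<close> of uniform size; its finitely many components that meet \<open>X_u\<close> form the
  multicone.
\<close>

section \<open>Operator norm and eigenvectors of two by two matrices\<close>

lemmas mat2_simps = vec_eq_iff forall_2 sum_2 matrix_matrix_mult_def matrix_vector_mult_def
  mat_def transpose_def det_2 trace_def inner_vec_def

lemma opnorm_bound: "norm (A *v x) \<le> opnorm A * norm x"
  unfolding opnorm_def by (rule onorm[OF matrix_vector_mul_bounded_linear])

lemma opnorm_nonneg [simp]: "0 \<le> opnorm A"
  unfolding opnorm_def by (rule onorm_pos_le[OF matrix_vector_mul_bounded_linear])

lemma opnorm_le: "(\<And>x. norm (A *v x) \<le> b * norm x) \<Longrightarrow> opnorm A \<le> b"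
  unfolding opnorm_def by (rule onorm_le)

lemma opnorm_zero_iff [simp]: "opnorm A = 0 \<longleftrightarrow> A = 0"
  unfolding opnorm_def onorm_eq_0[OF matrix_vector_mul_bounded_linear]
  by (metis matrix_eq matrix_vector_mult_0)

lemma opnorm_zero [simp]: "opnorm 0 = 0"
  by simp

lemma opnorm_pos_iff: "0 < opnorm A \<longleftrightarrow> A \<noteq> 0"
  using opnorm_nonneg[of A] opnorm_zero_iff[of A] by linarith

lemma opnorm_mat_1 [simp]: "opnorm (mat 1) = 1"
proof (rule antisym)
  show "opnorm (mat 1) \<le> 1" by (rule opnorm_le) simp
  show "1 \<le> opnorm (mat 1)" using opnorm_bound[of "mat 1" "axis 1 1"] by simp
qed

lemma opnorm_add_le: "opnorm (A + B) \<le> opnorm A + opnorm B"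
  by (rule opnorm_le)
    (smt (verit) matrix_vector_mult_add_rdistrib norm_triangle_ineq opnorm_bound ring_distribs(2))

lemma opnorm_scaleR [simp]: "opnorm (r *\<^sub>R A) = \<bar>r\<bar> * opnorm A"
  unfolding opnorm_def
  using onorm_scaleR[OF matrix_vector_mul_bounded_linear[of A], of r]
  by (simp add: scaleR_matrix_vector_assoc)

lemma opnorm_diff_le: "\<bar>opnorm A - opnorm B\<bar> \<le> opnorm (A - B)"
proof -
  have "opnorm (B - A) = opnorm (A - B)"
    using opnorm_scaleR[of "-1" "A - B"] by simp
  then show ?thesis
    using opnorm_add_le[of "A - B" B] opnorm_add_le[of "B - A" A] by simp
qed

lemma tendsto_opnorm:
  assumes "(f \<longlongrightarrow> A) F"
  shows "((\<lambda>x. opnorm (f x)) \<longlongrightarrow> opnorm A) F"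
proof -
  have "((\<lambda>x. \<Sum>i\<in>UNIV. \<Sum>j\<in>UNIV. \<bar>(f x - A) $ i $ j\<bar>) \<longlongrightarrow> (\<Sum>i\<in>UNIV. \<Sum>j\<in>UNIV. \<bar>(A - A) $ i $ j\<bar>)) F"
    by (intro tendsto_intros assms)
  then have lim: "((\<lambda>x. \<Sum>i\<in>UNIV. \<Sum>j\<in>UNIV. \<bar>(f x - A) $ i $ j\<bar>) \<longlongrightarrow> 0) F"
    by simp
  have "\<bar>opnorm (f x) - opnorm A\<bar> \<le> (\<Sum>i\<in>UNIV. \<Sum>j\<in>UNIV. \<bar>(f x - A) $ i $ j\<bar>)" for x
    using opnorm_diff_le[of "f x" A] onorm_le_matrix_component_sum[of "f x - A"]
    unfolding opnorm_def by linarith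
  then show ?thesis
    by (intro LIM_zero_cancel[OF Lim_null_comparison[OF _ lim]] always_eventually) simp
qed

lemma tendsto_matrix_mult:
  fixes A B :: mat2
  assumes "(f \<longlongrightarrow> A) F" "(g \<longlongrightarrow> B) F"
  shows "((\<lambda>x. f x ** g x) \<longlongrightarrow> A ** B) F"
  unfolding matrix_matrix_mult_def
  by (intro tendsto_intros assms tendsto_vec_lambda)

lemma tendsto_matrix_vector_mult:
  fixes A :: mat2
  assumes "(f \<longlongrightarrow> A) F" "(g \<longlongrightarrow> x) F"
  shows "((\<lambda>y. f y *v g y) \<longlongrightarrow> A *v x) F"
  unfolding matrix_vector_mult_def
  by (intro tendsto_intros assms tendsto_vec_lambda)

lemma scaleR_mult_scaleR: "(r *\<^sub>R A) ** (s *\<^sub>R B) = (r * s) *\<^sub>R (A ** B)" for A B :: mat2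
  by (simp add: mat2_simps algebra_simps)

lemma cayley_hamilton_2:
  fixes A :: mat2
  shows "A ** A = trace A *\<^sub>R A - det A *\<^sub>R mat 1"
  by (simp add: mat2_simps algebra_simps)

text \<open>By Cayley-Hamilton the columns \<open>?q\<close> and \<open>?p\<close> of
  \<open>A - m\<close> are killed by \<open>A - l\<close>. If both vanish, then \<open>A\<close> is
  the scalar \<open>l\<close> and any vector will do.\<close>

lemma eigenvector_exists:
  fixes A :: mat2
  assumes "l + m = trace A" "l * m = det A"
  shows "\<exists>p. p \<noteq> 0 \<and> A *v p = l *\<^sub>R p"
proof -
  have tr: "l + m = A$1$1 + A$2$2" and d: "l * m = A$1$1 * A$2$2 - A$1$2 * A$2$1"
    using assms by (simp_all add: mat2_simps)
  have m: "m = A$1$1 + A$2$2 - l" using tr by simp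
  have char: "l * (A$1$1 + A$2$2 - l) = A$1$1 * A$2$2 - A$1$2 * A$2$1" using d m by simp
  let ?p = "vector [A$1$2, l - A$1$1] :: vec2"
  let ?q = "vector [l - A$2$2, A$2$1] :: vec2"
  have "A$2$1 * A$1$2 + A$2$2 * (l - A$1$1) = l * (l - A$1$1)"
       "A$1$1 * (l - A$2$2) + A$1$2 * A$2$1 = l * (l - A$2$2)"
    using char by algebra+
  then have "A *v ?p = l *\<^sub>R ?p" "A *v ?q = l *\<^sub>R ?q"
    by (simp_all add: mat2_simps right_diff_distrib)
  moreover have "A *v axis 1 1 = l *\<^sub>R axis 1 1" "axis 1 1 \<noteq> (0 :: vec2)" if "?p = 0" "?q = 0"
    using that by (simp_all add: mat2_simps axis_def)
  ultimately show ?thesis by blast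
qed

section \<open>Eigenbases and proximality\<close>

definition wedge :: "vec2 \<Rightarrow> vec2 \<Rightarrow> real" where
  "wedge x y = x$1 * y$2 - x$2 * y$1"

lemma wedge_eq_0_imp_multiple:
  assumes "wedge x y = 0" "y \<noteq> 0"
  shows "\<exists>k. x = k *\<^sub>R y"
proof (cases "y$1 = 0")
  case True
  then have "y$2 \<noteq> 0" using assms(2) by (auto simp: mat2_simps)
  then have "x = (x$2 / y$2) *\<^sub>R y" using assms(1) True by (auto simp: wedge_def mat2_simps)
  then show ?thesis by blast
next
  case False
  then have "x = (x$1 / y$1) *\<^sub>R y" using assms(1) by (auto simp: wedge_def mat2_simps nonzero_eq_divide_eq)
  then show ?thesis by blast
qed

text \<open>Cramer's rule for the basis \<open>p\<close>, \<open>q\<close>.\<close>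

lemma wedge_decomposition:
  assumes "wedge p q \<noteq> 0"
  shows "x = (wedge x q / wedge p q) *\<^sub>R p + (wedge p x / wedge p q) *\<^sub>R q"
proof -
  have "wedge p q * x$1 = wedge x q * p$1 + wedge p x * q$1"
       "wedge p q * x$2 = wedge x q * p$2 + wedge p x * q$2"
    by (simp_all add: wedge_def algebra_simps)
  then have "x$1 = wedge x q * p$1 / wedge p q + wedge p x * q$1 / wedge p q"
            "x$2 = wedge x q * p$2 / wedge p q + wedge p x * q$2 / wedge p q"
    using assms by (metis add_divide_distrib nonzero_mult_div_cancel_left)+
  then show ?thesis by (simp add: vec_eq_iff forall_2)
qed

lemma eigenvectors_independent:
  assumes "A *v p = l *\<^sub>R p" "A *v q = m *\<^sub>R q" "p \<noteq> 0" "q \<noteq> 0" "l \<noteq> m"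
  shows "wedge p q \<noteq> 0"
proof
  assume "wedge p q = 0"
  then obtain k where k: "p = k *\<^sub>R q" using wedge_eq_0_imp_multiple assms by blast
  then have "A *v p = m *\<^sub>R p" using assms(2)
    by (metis matrix_vector_mult_scaleR scaleR_left_commute)
  then show False using assms by simp
qed

text \<open>\<open>u_space\<close> and \<open>s_space\<close> compare with every real eigenvalue, so
  coordinates in the eigenbasis serve twice: they show that \<open>l\<close> and \<open>m\<close>
  are the only eigenvalues, and they identify the two lines.\<close>

lemma proximal_eigenspaces:
  assumes A: "A *v p = l *\<^sub>R p" "A *v q = m *\<^sub>R q" "p \<noteq> 0" "q \<noteq> 0" "\<bar>m\<bar> < \<bar>l\<bar>"
  shows "proximal A" "u_space A = span {p}" "s_space A = span {q}"
proof -
  have w: "wedge p q \<noteq> 0" using eigenvectors_independent[OF A(1-4)] A(5) by auto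
  have ev: "real_eigenvalue A l" "real_eigenvalue A m"
    using A unfolding real_eigenvalue_def by blast+
  then show "proximal A" using A(5) unfolding proximal_def by (metis less_irrefl)
  have coords: "\<exists>a b. v = a *\<^sub>R p + b *\<^sub>R q \<and> (k - l) * a = 0 \<and> (k - m) * b = 0" if "A *v v = k *\<^sub>R v" for v k
  proof -
    obtain a b where ab: "v = a *\<^sub>R p + b *\<^sub>R q" using wedge_decomposition[OF w] by blast
    have "A *v v = (a * l) *\<^sub>R p + (b * m) *\<^sub>R q"
      unfolding ab by (simp add: matrix_vector_right_distrib matrix_vector_mult_scaleR A)
    then have "((k - l) * a) *\<^sub>R p + ((k - m) * b) *\<^sub>R q = 0" (is "?c *\<^sub>R p + ?d *\<^sub>R q = 0")
      using that unfolding ab by (simp add: algebra_simps)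
    moreover have "wedge (?c *\<^sub>R p + ?d *\<^sub>R q) q = ?c * wedge p q" "wedge p (?c *\<^sub>R p + ?d *\<^sub>R q) = ?d * wedge p q"
      by (simp_all add: wedge_def algebra_simps)
    ultimately have "?c * wedge p q = 0" "?d * wedge p q = 0" by (simp_all add: wedge_def)
    then show ?thesis using ab w by auto
  qed
  have eig: "k = l \<or> k = m" if "real_eigenvalue A k" for k
  proof -
    obtain v where v: "v \<noteq> 0" "A *v v = k *\<^sub>R v" using \<open>real_eigenvalue A k\<close> unfolding real_eigenvalue_def by blast
    then show ?thesis using coords[OF v(2)] by auto
  qed
  have "v \<in> span {p}" if v: "v \<in> u_space A" for v
  proof -
    obtain k where k: "A *v v = k *\<^sub>R v" "\<bar>l\<bar> \<le> \<bar>k\<bar>" using v ev unfolding u_space_def by blast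
    then show ?thesis using coords[OF k(1)] A(5) by (auto simp: span_singleton)
  qed
  moreover have "c *\<^sub>R p \<in> u_space A" for c
    unfolding u_space_def using eig A
    by (force simp: matrix_vector_mult_scaleR intro!: exI[of _ l] dest: less_imp_le)
  ultimately show "u_space A = span {p}" by (auto simp: span_singleton)
  have "v \<in> span {q}" if v: "v \<in> s_space A" for v
  proof -
    obtain k where k: "A *v v = k *\<^sub>R v" "\<bar>k\<bar> \<le> \<bar>m\<bar>" using v ev unfolding s_space_def by blast
    then show ?thesis using coords[OF k(1)] A(5) by (auto simp: span_singleton)
  qed
  moreover have "c *\<^sub>R q \<in> s_space A" for c
    unfolding s_space_def using eig A
    by (force simp: matrix_vector_mult_scaleR intro!: exI[of _ m] dest: less_imp_le)
  ultimately show "s_space A = span {q}" by (auto simp: span_singleton)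
qed

lemma proximalE:
  assumes "proximal A"
  obtains l m p q where "A *v p = l *\<^sub>R p" "A *v q = m *\<^sub>R q" "p \<noteq> 0" "q \<noteq> 0" "\<bar>m\<bar> < \<bar>l\<bar>"
  using assms unfolding proximal_def real_eigenvalue_def by (metis linorder_less_linear)

text \<open>If the inequality fails, the discriminant is positive and the trace is nonzero, so the
  roots of the characteristic polynomial are real and neither equal nor opposite.\<close>

lemma not_proximal_trace_le:
  assumes "\<not> proximal A"
  shows "(trace A)\<^sup>2 \<le> 4 * \<bar>det A\<bar>"
proof (rule ccontr)
  assume less: "\<not> ?thesis"
  define s where "s = sqrt ((trace A)\<^sup>2 - 4 * det A)"
  have pos: "(trace A)\<^sup>2 - 4 * det A > 0" and tr: "trace A \<noteq> 0" using less by auto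
  then have s: "s > 0" "s * s = (trace A)\<^sup>2 - 4 * det A" unfolding s_def by auto
  define l m where "l = (trace A + s) / 2" and "m = (trace A - s) / 2"
  have lm: "l + m = trace A" "l * m = det A"
    using s(2) by (simp_all add: l_def m_def field_simps power2_eq_square)
  have "real_eigenvalue A l" using eigenvector_exists[OF lm] unfolding real_eigenvalue_def by blast
  moreover have "real_eigenvalue A m" using eigenvector_exists[of m l A] lm
    unfolding real_eigenvalue_def by (metis add.commute mult.commute)
  moreover have "\<bar>l\<bar> \<noteq> \<bar>m\<bar>" using s(1) tr by (auto simp: l_def m_def abs_eq_iff)
  ultimately show False using assms unfolding proximal_def by blast
qed

section \<open>Rank one matrices\<close>

definition outer :: "vec2 \<Rightarrow> vec2 \<Rightarrow> mat2" where
  "outer v w = (\<chi> i j. v$i * w$j)"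

lemma outer_mult_vec: "outer v w *v x = (w \<bullet> x) *\<^sub>R v"
  by (simp add: outer_def mat2_simps algebra_simps)

lemma mult_outer: "A ** outer v w = outer (A *v v) w"
  by (simp add: outer_def mat2_simps algebra_simps)

lemma outer_mult_outer: "outer v w ** outer v w = (w \<bullet> v) *\<^sub>R outer v w"
  by (simp add: outer_def mat2_simps algebra_simps)

lemma trace_outer: "trace (outer v w) = w \<bullet> v"
  by (simp add: outer_def mat2_simps algebra_simps)

lemma det_outer: "det (outer v w) = 0"
  by (simp add: outer_def mat2_simps algebra_simps)

lemma opnorm_outer: "opnorm (outer v w) = norm v * norm w"
proof (rule antisym)
  show "opnorm (outer v w) \<le> norm v * norm w"
  proof (rule opnorm_le)
    fix x
    have "\<bar>w \<bullet> x\<bar> * norm v \<le> norm w * norm x * norm v"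
      by (intro mult_right_mono Cauchy_Schwarz_ineq2 norm_ge_zero)
    then show "norm (outer v w *v x) \<le> norm v * norm w * norm x"
      by (simp add: outer_mult_vec mult_ac)
  qed
  show "norm v * norm w \<le> opnorm (outer v w)"
  proof (cases "w = 0")
    case False
    have "norm w * (norm v * norm w) \<le> opnorm (outer v w) * norm w"
      using opnorm_bound[of "outer v w" w] by (simp add: outer_mult_vec dot_square_norm power2_eq_square mult_ac)
    then show ?thesis using False by simp
  qed simp
qed

section \<open>Angles and the projective line\<close>

definition dir :: "real \<Rightarrow> vec2" where
  "dir t = vector [cos t, sin t]"

lemma line_of_angle_dir: "line_of_angle t = span {dir t}"
  by (simp add: line_of_angle_def dir_def)

lemma dir_nth [simp]: "dir t $ 1 = cos t" "dir t $ 2 = sin t"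
  by (simp_all add: dir_def)

lemma norm_dir [simp]: "norm (dir t) = 1"
  by (simp add: norm_eq_1 inner_vec_def sum_2 flip: power2_eq_square)

lemma dir_nonzero [simp]: "dir t \<noteq> 0"
  by (metis norm_dir norm_zero zero_neq_one)

lemma wedge_dir: "wedge (dir s) (dir t) = sin (t - s)"
  by (simp add: wedge_def sin_diff)

lemma wedge_scaleR_left: "wedge (r *\<^sub>R x) y = r * wedge x y"
  by (simp add: wedge_def algebra_simps)

text \<open>A chord of the unit circle has length \<open>2 * sin ((s - t) / 2)\<close> up to sign,
  which is at most the arc.\<close>

lemma norm_dir_diff_le: "norm (dir s - dir t) \<le> \<bar>s - t\<bar>"
proof -
  have "(norm (dir s - dir t))\<^sup>2 = (cos s - cos t)\<^sup>2 + (sin s - sin t)\<^sup>2"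
    by (simp add: power2_norm_eq_inner inner_vec_def sum_2 flip: power2_eq_square)
  also have "\<dots> = ((sin s)\<^sup>2 + (cos s)\<^sup>2) + ((sin t)\<^sup>2 + (cos t)\<^sup>2) - 2 * (cos s * cos t + sin s * sin t)"
    by (simp only: power2_eq_square) (simp add: algebra_simps)
  also have "\<dots> = 2 - 2 * cos (2 * ((s - t) / 2))"
    by (simp only: times_divide_eq_right nonzero_mult_div_cancel_left[OF zero_neq_numeral[symmetric]] cos_diff)
      (simp add: algebra_simps)
  also have "\<dots> = (2 * sin ((s - t) / 2))\<^sup>2"
    unfolding cos_double_sin by (simp add: power_mult_distrib)
  also have "\<dots> \<le> (s - t)\<^sup>2"
    using abs_sin_x_le_abs_x[of "(s - t) / 2"] by (subst abs_le_square_iff[symmetric]) (simp add: abs_mult)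
  finally show ?thesis by (metis abs_ge_zero power2_abs power2_le_imp_le)
qed

lemma continuous_on_dir: "continuous_on X dir"
  unfolding continuous_on_iff dist_norm
  by (metis norm_dir_diff_le order_le_less_trans real_norm_def)

lemma span_scaleR: "r \<noteq> 0 \<Longrightarrow> span {r *\<^sub>R (v::vec2)} = span {v}"
proof (intro subset_antisym subsetI)
  fix x assume r: "r \<noteq> 0" and "x \<in> span {v}"
  then obtain k where "x = k *\<^sub>R v" by (auto simp: span_singleton)
  then have "x = (k / r) *\<^sub>R (r *\<^sub>R v)" using r by simp
  then show "x \<in> span {r *\<^sub>R v}" unfolding span_singleton by blast
qed (auto simp: span_singleton)

lemma line_of_angle_in_RP1 [simp]: "line_of_angle t \<in> RP1"
  by (simp add: RP1_def line_of_angle_dir dim_singleton)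

text \<open>The factor \<open>r\<close> may be negative, so a window of length \<open>pi\<close>
  suffices. Its start \<open>\<sigma>\<close> is left free because the projective line is later cut
  at a stable line.\<close>

lemma polar:
  assumes "v \<noteq> (0::vec2)"
  obtains t r where "\<sigma> \<le> t" "t < \<sigma> + pi" "r \<noteq> 0" "v = r *\<^sub>R dir t"
proof -
  have "(v$1 / norm v)\<^sup>2 + (v$2 / norm v)\<^sup>2 = ((v$1)\<^sup>2 + (v$2)\<^sup>2) / (norm v)\<^sup>2"
    by (simp add: power_divide add_divide_distrib)
  also have "(v$1)\<^sup>2 + (v$2)\<^sup>2 = (norm v)\<^sup>2"
    by (simp add: power2_norm_eq_inner inner_vec_def sum_2 flip: power2_eq_square)
  finally have "(v$1 / norm v)\<^sup>2 + (v$2 / norm v)\<^sup>2 = 1"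
    using assms by simp
  then obtain s where s: "v$1 / norm v = cos s" "v$2 / norm v = sin s"
    by (metis sincos_total_2pi)
  have v: "v = norm v *\<^sub>R dir s"
    using assms by (simp add: vec_eq_iff forall_2 flip: s)
  \<comment> \<open>Shifting the angle into the window by \<open>k\<close> multiples of
    \<open>pi\<close> reverses the direction when \<open>k\<close> is odd; \<open>e\<close> records
    this sign.\<close>
  define k where "k = \<lfloor>(s - \<sigma>) / pi\<rfloor>"
  define t where "t = s - pi * of_int k"
  have "of_int k \<le> (s - \<sigma>) / pi" "(s - \<sigma>) / pi < of_int k + 1"
    by (simp_all add: k_def)
  then have "\<sigma> \<le> t" "t < \<sigma> + pi"
    by (simp_all add: t_def field_simps)
  moreover define e :: real where "e = (if even k then 1 else -1)"
  have "dir t = e *\<^sub>R dir s"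
    by (simp add: t_def e_def vec_eq_iff forall_2 sin_diff cos_diff)
  then have "v = (norm v * e) *\<^sub>R dir t"
    using v by (simp add: e_def)
  moreover have "norm v * e \<noteq> 0" using assms by (simp add: e_def)
  ultimately show ?thesis using that by blast
qed

lemma RP1_angle:
  assumes "L \<in> RP1"
  obtains t where "\<sigma> \<le> t" "t < \<sigma> + pi" "L = line_of_angle t"
proof -
  have "\<not> L \<subseteq> {0}" using assms dim_eq_0[of L] by (auto simp: RP1_def)
  then obtain v where v: "v \<noteq> 0" "v \<in> L" by blast
  obtain t r where t: "\<sigma> \<le> t" "t < \<sigma> + pi" "r \<noteq> 0" "v = r *\<^sub>R dir t"
    by (rule polar[OF v(1)])
  have L: "subspace L" "dim L = 1" using assms by (auto simp: RP1_def)
  have "span {v} \<subseteq> L" using v L by (simp add: span_minimal)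
  then have "span {v} = L"
    using L v by (intro subspace_dim_equal) (auto simp: dim_singleton)
  then have "L = line_of_angle t" using span_scaleR[OF t(3)] t(4) by (simp add: line_of_angle_dir)
  then show ?thesis using that t by blast
qed

lemma line_of_angle_eq_iff: "line_of_angle s = line_of_angle t \<longleftrightarrow> sin (s - t) = 0"
proof
  assume "line_of_angle s = line_of_angle t"
  then have "dir s \<in> span {dir t}" unfolding line_of_angle_dir by (metis span_base singletonI)
  then obtain k where "dir s = k *\<^sub>R dir t" by (auto simp: span_singleton)
  then have "wedge (dir t) (dir s) = 0" by (simp add: wedge_def)
  then show "sin (s - t) = 0" by (simp add: wedge_dir)
next
  assume "sin (s - t) = 0"
  then have "wedge (dir s) (dir t) = 0" by (metis wedge_dir minus_diff_eq neg_0_equal_iff_equal sin_minus)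
  then obtain k where k: "dir s = k *\<^sub>R dir t" using wedge_eq_0_imp_multiple by force
  then have "k \<noteq> 0" by (metis dir_nonzero scale_zero_left)
  then show "line_of_angle s = line_of_angle t" by (simp add: line_of_angle_dir k span_scaleR)
qed

section \<open>Topology of the projective line\<close>

text \<open>\<open>topology\<close> yields the intended open sets once the predicate is known to
  satisfy \<open>istopology\<close>.\<close>

lemma openin_RP1_top: "openin RP1_top U \<longleftrightarrow> U \<subseteq> RP1 \<and> open (line_of_angle -` U)"
proof -
  have "istopology (\<lambda>U. U \<subseteq> RP1 \<and> open (line_of_angle -` U))"
    unfolding istopology_def by (auto simp: vimage_Union open_Int open_UN)
  then show ?thesis unfolding RP1_top_def by simp
qed

lemma topspace_RP1_top [simp]: "topspace RP1_top = RP1"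
proof -
  have "line_of_angle -` RP1 = UNIV" by auto
  then have "openin RP1_top RP1" by (simp add: openin_RP1_top)
  then show ?thesis by (metis openin_RP1_top openin_subset openin_topspace subset_antisym)
qed

text \<open>Saturating \<open>V\<close> adds its translates by multiples of \<open>pi\<close>, and a
  union of translates of an open set is open.\<close>

lemma openin_line_image:
  assumes "open V"
  shows "openin RP1_top (line_of_angle ` V)"
proof -
  have "line_of_angle -` line_of_angle ` V = (\<Union>k::int. (+) (of_int k * pi) ` V)"
  proof (intro set_eqI iffI)
    fix s assume "s \<in> line_of_angle -` line_of_angle ` V"
    then obtain v where v: "v \<in> V" "sin (s - v) = 0" by (auto simp: line_of_angle_eq_iff)
    then obtain k :: int where "s - v = of_int k * pi" by (auto simp: sin_zero_iff_int2)
    then have "s = of_int k * pi + v" by simp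
    then show "s \<in> (\<Union>k::int. (+) (of_int k * pi) ` V)" using v(1) by blast
  next
    fix s assume "s \<in> (\<Union>k::int. (+) (of_int k * pi) ` V)"
    then obtain k :: int and v where "v \<in> V" "s = of_int k * pi + v" by blast
    moreover from this have "sin (s - v) = 0" by (auto simp: sin_zero_iff_int2)
    then have "line_of_angle s = line_of_angle v" by (simp add: line_of_angle_eq_iff)
    ultimately show "s \<in> line_of_angle -` line_of_angle ` V" by auto
  qed
  then show ?thesis using assms by (auto simp: openin_RP1_top intro!: open_UN open_translation)
qed

lemma continuous_map_line_of_angle: "continuous_map euclidean RP1_top line_of_angle"
  by (auto simp: continuous_map_def openin_RP1_top vimage_def)

text \<open>Since the angle map is open, the lines with angle near \<open>t\<close> form a
  neighbourhood; approximation of lines thus becomes approximation of angles.\<close>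

lemma closure_of_RP1_near:
  assumes "line_of_angle t \<in> RP1_top closure_of Y" "e > 0"
  shows "\<exists>s. \<bar>t - s\<bar> < e \<and> line_of_angle s \<in> Y"
proof -
  have "line_of_angle t \<in> line_of_angle ` ball t e" using assms(2) by simp
  then obtain y where "y \<in> Y" "y \<in> line_of_angle ` ball t e"
    using assms(1) openin_line_image[OF open_ball] unfolding in_closure_of by blast
  then show ?thesis by (auto simp: dist_real_def)
qed

text \<open>The quotient is the tangent of the angle from \<open>dir t\<close> to \<open>z\<close>.
  The formula selects an angle that varies continuously with \<open>z\<close> and equals
  \<open>t\<close> at nonzero multiples of \<open>dir t\<close>.\<close>

lemma span_eq_line_of_angle:
  assumes "dir t \<bullet> z \<noteq> 0"
  shows "span {z} = line_of_angle (t + arctan (wedge (dir t) z / (dir t \<bullet> z)))"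
proof -
  define d w where "d = dir t \<bullet> z" and "w = wedge (dir t) z"
  define f where "f = arctan (w / d)"
  have c: "cos f \<noteq> 0" unfolding f_def by (rule cos_arctan_not_zero)
  have "tan f = w / d" by (simp add: f_def tan_arctan)
  then have s: "sin f = w / d * cos f" using c by (simp add: tan_def field_simps)
  have d0: "d \<noteq> 0" using assms by (simp add: d_def)
  have "d * cos t - w * sin t = z$1 * ((sin t)\<^sup>2 + (cos t)\<^sup>2)"
       "d * sin t + w * cos t = z$2 * ((sin t)\<^sup>2 + (cos t)\<^sup>2)"
    by (simp_all add: d_def w_def wedge_def inner_vec_def sum_2 power2_eq_square algebra_simps del: sin_cos_squared_add3)
  then have z: "z$1 = d * cos t - w * sin t" "z$2 = d * sin t + w * cos t"
    by simp_all
  have "z = (d / cos f) *\<^sub>R dir (t + f)"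
    using c d0 by (simp add: vec_eq_iff forall_2 z cos_add sin_add s field_simps)
  then show ?thesis
    using span_scaleR[of "d / cos f" "dir (t + f)"] c d0 unfolding line_of_angle_dir f_def d_def w_def by simp
qed

text \<open>The angle from \<open>span_eq_line_of_angle\<close> turns convergence of vectors to a
  nonzero limit into convergence of angles.\<close>

lemma line_in_closure_of:
  fixes z :: "nat \<Rightarrow> vec2"
  assumes lim: "z \<longlonglongrightarrow> r *\<^sub>R dir t" and r: "r \<noteq> 0"
    and Y: "eventually (\<lambda>n. span {z n} \<in> Y) sequentially"
  shows "line_of_angle t \<in> RP1_top closure_of Y"
  unfolding in_closure_of
proof (intro conjI allI impI)
  show "line_of_angle t \<in> topspace RP1_top" by simp
  fix U assume U: "line_of_angle t \<in> U \<and> openin RP1_top U"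
  define f where "f n = t + arctan (wedge (dir t) (z n) / (dir t \<bullet> z n))" for n
  have inn: "dir t \<bullet> (r *\<^sub>R dir t) = r" by (simp add: dot_square_norm)
  have wlim: "(\<lambda>n. wedge (dir t) (z n)) \<longlonglongrightarrow> wedge (dir t) (r *\<^sub>R dir t)"
    unfolding wedge_def by (intro tendsto_intros lim)
  have ilim: "(\<lambda>n. dir t \<bullet> z n) \<longlonglongrightarrow> r"
    using tendsto_inner[OF tendsto_const lim, of "dir t"] by (simp only: inn)
  have "f \<longlonglongrightarrow> t + arctan (wedge (dir t) (r *\<^sub>R dir t) / r)"
    unfolding f_def by (intro tendsto_intros wlim ilim r)
  then have "f \<longlonglongrightarrow> t" by (simp add: wedge_def)
  moreover have "open (line_of_angle -` U)" "t \<in> line_of_angle -` U" using U by (auto simp: openin_RP1_top)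
  ultimately have "eventually (\<lambda>n. f n \<in> line_of_angle -` U) sequentially"
    by (rule topological_tendstoD)
  moreover have "eventually (\<lambda>n. dir t \<bullet> z n \<noteq> 0) sequentially"
    using tendsto_imp_eventually_ne[OF ilim r] .
  ultimately have "eventually (\<lambda>n. span {z n} \<in> Y \<and> span {z n} \<in> U) sequentially"
    using Y by eventually_elim (simp add: span_eq_line_of_angle f_def)
  then show "\<exists>y. y \<in> Y \<and> y \<in> U"
    using eventually_happens'[OF sequentially_bot] by blast
qed

text \<open>Two lines separate the projective line into two arcs, on which the product of the two
  corresponding linear forms has opposite signs.\<close>
lemma connected_meets_line:
  assumes K: "connected K" "r1 *\<^sub>R dir t1 \<in> K" "r2 *\<^sub>R dir t2 \<in> K" "r1 \<noteq> 0" "r2 \<noteq> 0"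
    and t: "\<sigma> < t1" "t1 < c" "c < t2" "t2 < \<sigma> + pi"
  shows "\<exists>x\<in>K. x \<in> line_of_angle \<sigma> \<or> x \<in> line_of_angle c"
proof -
  define f where "f x = wedge x (dir \<sigma>) * wedge x (dir c)" for x
  have "continuous_on K f"
    unfolding f_def wedge_def by (intro continuous_intros)
  then have conn: "connected (f ` K)" using K(1) by (rule connected_continuous_image)
  have sgn: "f (r *\<^sub>R dir s) = r\<^sup>2 * (sin (s - \<sigma>) * sin (s - c))" for r s
    using sin_minus[of "s - \<sigma>"] sin_minus[of "s - c"]
    by (simp add: f_def wedge_scaleR_left wedge_dir power2_eq_square)
  have "sin (t1 - \<sigma>) > 0" "sin (t2 - \<sigma>) > 0" "sin (t2 - c) > 0" "sin (c - t1) > 0"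
    using t by (auto intro!: sin_gt_zero)
  then have "sin (t1 - \<sigma>) * sin (t1 - c) \<le> 0" "0 \<le> sin (t2 - \<sigma>) * sin (t2 - c)"
    using sin_minus[of "c - t1"] by (auto simp: mult_le_0_iff)
  then have "f (r1 *\<^sub>R dir t1) \<le> 0" "0 \<le> f (r2 *\<^sub>R dir t2)"
    unfolding sgn by (simp_all add: mult_nonneg_nonpos)
  then have "0 \<in> f ` K"
    using connectedD_interval[OF conn, of "f (r1 *\<^sub>R dir t1)" "f (r2 *\<^sub>R dir t2)" 0] K by blast
  then obtain x where x: "x \<in> K" "f x = 0" by auto
  then have "wedge x (dir \<sigma>) = 0 \<or> wedge x (dir c) = 0" by (simp add: f_def)
  then have "x \<in> line_of_angle \<sigma> \<or> x \<in> line_of_angle c"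
    unfolding line_of_angle_dir span_singleton using wedge_eq_0_imp_multiple dir_nonzero by blast
  then show ?thesis using x(1) by blast
qed

lemma act_span: "act A (span {v}) = span {A *v v}"
  by (auto simp: act_def span_singleton matrix_vector_mult_scaleR image_iff)

section \<open>Semigroups without proximal elements\<close>

lemma foldr_matrix_mult: "foldr (**) xs (B :: mat2) = foldr (**) xs (mat 1) ** B"
  by (induction xs) (auto simp flip: matrix_mul_assoc)

lemma gen_semigroup_mult:
  assumes "A \<in> gen_semigroup AA" "B \<in> gen_semigroup AA"
  shows "A ** B \<in> gen_semigroup AA"
proof -
  obtain xs ys where "A = foldr (**) xs (mat 1)" "xs \<noteq> []" "set xs \<subseteq> AA"
    "B = foldr (**) ys (mat 1)" "set ys \<subseteq> AA"
    using assms unfolding gen_semigroup_def by blast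
  then have "A ** B = foldr (**) (xs @ ys) (mat 1) \<and> xs @ ys \<noteq> [] \<and> set (xs @ ys) \<subseteq> AA"
    by (simp add: foldr_matrix_mult[of xs "foldr (**) ys (mat 1)"])
  then show ?thesis unfolding gen_semigroup_def by blast
qed

lemma gen_semigroup_base: "A \<in> AA \<Longrightarrow> A \<in> gen_semigroup AA"
  unfolding gen_semigroup_def by (intro CollectI exI[of _ "[A]"]) simp

lemma gen_semigroup_induct [consumes 1, case_names base step]:
  assumes "A \<in> gen_semigroup AA"
    and base: "\<And>A. A \<in> AA \<Longrightarrow> P A"
    and step: "\<And>A B. A \<in> AA \<Longrightarrow> P B \<Longrightarrow> P (A ** B)"
  shows "P A"
proof -
  have "P (foldr (**) xs (mat 1))" if "xs \<noteq> []" "set xs \<subseteq> AA" for xs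
    using that
  proof (induction xs)
    case (Cons x xs)
    \<comment> \<open>The empty product \<open>mat 1\<close> need not lie in the semigroup, so lists
      of length one form the base case.\<close>
    then show ?case using base[of x] step[of x] by (cases "xs = []") auto
  qed simp
  then show ?thesis using assms(1) unfolding gen_semigroup_def by blast
qed

lemma gen_semigroup_invertible:
  assumes "\<forall>A\<in>AA. invertible A" "A \<in> gen_semigroup AA"
  shows "invertible A"
  using assms(2)
  by (induction rule: gen_semigroup_induct) (use assms(1) invertible_mult in blast)+

lemma matrix_inv_inverse:
  assumes "invertible A"
  shows "A ** matrix_inv A = mat 1" "matrix_inv A ** A = mat 1"
  using someI_ex[OF assms[unfolded invertible_def]] by (simp_all add: matrix_inv_def)

lemma orthogonal_matrix_norm:
  fixes Q :: mat2
  assumes "orthogonal_matrix Q"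
  shows "norm (Q *v x) = norm x"
  using assms orthogonal_transformation_matrix[of "(*v) Q"] orthogonal_transformation_norm by auto

text \<open>For the norm \<open>norm (M *v x)\<close> every generator is a similarity, hence so is
  every product, and a similarity stretches all its eigenvectors by the same factor.\<close>

lemma strongly_conformal_not_proximal:
  assumes inv: "\<forall>A\<in>AA. invertible A" and "strongly_conformal AA" and A: "A \<in> gen_semigroup AA"
  shows "\<not> proximal A"
proof -
  obtain M :: mat2 where M: "invertible M"
    and orth: "\<And>A. A \<in> AA \<Longrightarrow> orthogonal_matrix ((\<bar>det A\<bar> powr (-1/2)) *\<^sub>R (M ** A ** matrix_inv M))"
    using assms(2) unfolding strongly_conformal_def by blast
  have base: "\<exists>r. \<forall>x. norm (M *v (A *v x)) = r * norm (M *v x)" if A: "A \<in> AA" for A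
  proof (intro exI allI)
    fix x
    define c where "c = \<bar>det A\<bar> powr (-1/2)"
    have "det A \<noteq> 0" using inv A by (auto simp: invertible_det_nz)
    then have c: "c > 0" by (simp add: c_def)
    have "(c *\<^sub>R (M ** A ** matrix_inv M)) *v (M *v x) = c *\<^sub>R ((M ** A ** (matrix_inv M ** M)) *v x)"
      unfolding scaleR_matrix_vector_assoc[symmetric]
      by (simp only: matrix_mul_assoc matrix_vector_mul_assoc)
    also have "\<dots> = c *\<^sub>R (M *v (A *v x))"
      using M by (simp add: matrix_inv_inverse matrix_vector_mul_assoc)
    finally have "norm (c *\<^sub>R (M *v (A *v x))) = norm (M *v x)"
      using orthogonal_matrix_norm[OF orth[OF A]] unfolding c_def by metis
    then show "norm (M *v (A *v x)) = inverse (\<bar>det A\<bar> powr (-1/2)) * norm (M *v x)"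
      using c unfolding c_def[symmetric] by (simp add: field_simps)
  qed
  have "\<exists>r. \<forall>x. norm (M *v (A *v x)) = r * norm (M *v x)"
    using A
  proof (induction rule: gen_semigroup_induct)
    case (step A B)
    obtain r s where "\<And>x. norm (M *v (B *v x)) = r * norm (M *v x)" "\<And>x. norm (M *v (A *v x)) = s * norm (M *v x)"
      using step.IH base[OF step.hyps] by blast
    then have "norm (M *v ((A ** B) *v x)) = (s * r) * norm (M *v x)" for x
      by (simp flip: matrix_vector_mul_assoc)
    then show ?case by blast
  qed (rule base)
  then obtain r where r: "\<And>x. norm (M *v (A *v x)) = r * norm (M *v x)" by blast
  have "\<bar>l\<bar> = r" if "p \<noteq> 0" "A *v p = l *\<^sub>R p" for l p
  proof -
    have "M *v p \<noteq> 0" using M that(1)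
      by (metis invertible_left_inverse matrix_left_invertible_ker)
    moreover have "\<bar>l\<bar> * norm (M *v p) = r * norm (M *v p)"
      using r[of p] by (simp add: that(2) matrix_vector_mult_scaleR)
    ultimately show ?thesis by simp
  qed
  then show ?thesis unfolding proximal_def real_eigenvalue_def by metis
qed

text \<open>Cayley-Hamilton and the trace bound give
  \<open>\<kappa> * N * N \<le> 2 * d * N + d * d\<close>, a quadratic inequality that bounds
  \<open>N\<close> by a multiple of \<open>d\<close>.\<close>

lemma not_proximal_opnorm_le:
  assumes k: "0 < \<kappa>" "\<kappa> \<le> 1" and am: "\<kappa> * opnorm A * opnorm A \<le> opnorm (A ** A)"
    and "\<not> proximal A"
  shows "opnorm A \<le> 3 / \<kappa> * sqrt \<bar>det A\<bar>"
proof -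
  define d N where "d = sqrt \<bar>det A\<bar>" and "N = opnorm A"
  have d: "0 \<le> d" "d\<^sup>2 = \<bar>det A\<bar>" and N: "0 \<le> N" by (simp_all add: d_def N_def)
  have "(trace A)\<^sup>2 \<le> (2 * d)\<^sup>2"
    using not_proximal_trace_le[OF assms(4)] d by (simp add: power_mult_distrib)
  then have tr: "\<bar>trace A\<bar> \<le> 2 * d" using d(1) by (metis abs_le_square_iff abs_of_nonneg mult_nonneg_nonneg zero_le_numeral)
  have "opnorm (A ** A) \<le> \<bar>trace A\<bar> * N + \<bar>det A\<bar>"
    using opnorm_add_le[of "trace A *\<^sub>R A" "(- det A) *\<^sub>R mat 1"]
    by (simp add: cayley_hamilton_2 N_def del: scaleR_minus_left) simp
  then have le: "\<kappa> * N * N \<le> 2 * d * N + d * d"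
    using am mult_right_mono[OF tr N] d by (simp add: N_def power2_eq_square)
  have "\<kappa> * N \<le> 3 * d"
  \<comment> \<open>For \<open>N \<le> d\<close> the bound follows from
    \<open>\<kappa> \<le> 1\<close>; otherwise \<open>d * d \<le> d * N\<close> and a factor
    \<open>N\<close> cancels.\<close>
  proof (cases "N \<le> d")
    case True
    then show ?thesis using mult_mono[OF k(2) True] N d by linarith
  next
    case False
    then have "d * d \<le> d * N" using d by (simp add: mult_left_mono)
    then have "(\<kappa> * N) * N \<le> (3 * d) * N" using le by simp
    then show ?thesis using False d by (simp add: mult_le_cancel_right)
  qed
  then show ?thesis using k by (simp add: N_def d_def field_simps)
qed

section \<open>Normalised determinants and positive definite forms\<close>

definition unimod :: "mat2 \<Rightarrow> mat2" where
  "unimod A = (\<bar>det A\<bar> powr (-1/2)) *\<^sub>R A"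

lemma unimod_mult: "unimod (A ** B) = unimod A ** unimod B"
  by (simp add: unimod_def scaleR_mult_scaleR det_mul abs_mult powr_mult)

lemma det_unimod:
  assumes "invertible A"
  shows "(det (unimod A))\<^sup>2 = 1"
proof -
  have nz: "\<bar>det A\<bar> > 0" using assms by (simp add: invertible_det_nz)
  have "det (r *\<^sub>R A) = r\<^sup>2 * det A" for r
    by (simp add: mat2_simps algebra_simps power2_eq_square)
  then have "(det (unimod A))\<^sup>2 = ((\<bar>det A\<bar> powr (-1/2))\<^sup>2 * \<bar>det A\<bar>)\<^sup>2"
    by (simp add: unimod_def power_mult_distrib)
  also have "(\<bar>det A\<bar> powr (-1/2))\<^sup>2 = inverse \<bar>det A\<bar>"
    using nz by (simp add: power2_eq_square flip: powr_add) (simp add: powr_minus divide_inverse)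
  finally show ?thesis using nz by simp
qed

text \<open>The determinant bound and the signs on the diagonal make these symmetric matrices
  positive definite; the bound 1, in place of mere positivity, keeps the set closed.\<close>

definition pos_forms :: "mat2 set" where
  "pos_forms = {X. X$1$2 = X$2$1 \<and> 0 \<le> X$1$1 \<and> 0 \<le> X$2$2 \<and> 1 \<le> det X}"

lemma closed_pos_forms: "closed pos_forms"
  unfolding pos_forms_def det_2
  by (intro closed_Collect_conj closed_Collect_eq closed_Collect_le continuous_intros)

lemma convex_pos_forms: "convex pos_forms"
proof (rule convexI)
  fix X Y and u v :: real
  assume X: "X \<in> pos_forms" and Y: "Y \<in> pos_forms" and uv: "0 \<le> u" "0 \<le> v" "u + v = 1"
  define a b d a' b' d' where "a = X$1$1" and "b = X$1$2" and "d = X$2$2"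
    and "a' = Y$1$1" and "b' = Y$1$2" and "d' = Y$2$2"
  have nn: "0 \<le> a" "0 \<le> d" "0 \<le> a'" "0 \<le> d'" and sym: "X$2$1 = b" "Y$2$1 = b'"
    and ge: "1 + b\<^sup>2 \<le> a * d" "1 + b'\<^sup>2 \<le> a' * d'"
    using X Y by (auto simp: pos_forms_def det_2 a_def b_def d_def a'_def b'_def d'_def power2_eq_square)
  \<comment> \<open>Cauchy-Schwarz for \<open>(1, b)\<close> and \<open>(1, b')\<close>, followed by
    the arithmetic-geometric mean inequality, controls the mixed term in the determinant of the
    combination.\<close>
  have "(1 + b * b')\<^sup>2 \<le> (1 + b\<^sup>2) * (1 + b'\<^sup>2)"
    using zero_le_power2[of "b - b'"] by (simp add: power2_eq_square algebra_simps)
  also have "\<dots> \<le> (a * d) * (a' * d')"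
    by (intro mult_mono ge) (use nn in auto)
  also have "4 * \<dots> \<le> (a * d' + a' * d)\<^sup>2"
    using zero_le_power2[of "a * d' - a' * d"] by (simp add: power2_eq_square algebra_simps)
  finally have "(2 * (1 + b * b'))\<^sup>2 \<le> (a * d' + a' * d)\<^sup>2"
    by (simp only: power_mult_distrib) simp
  then have cross: "2 * (1 + b * b') \<le> a * d' + a' * d"
    by (rule power2_le_imp_le) (use nn in auto)
  have "(u + v)\<^sup>2 + (u * b + v * b')\<^sup>2 = u\<^sup>2 * (1 + b\<^sup>2) + v\<^sup>2 * (1 + b'\<^sup>2) + u * v * (2 * (1 + b * b'))"
    by (simp add: power2_eq_square algebra_simps)
  also have "\<dots> \<le> u\<^sup>2 * (a * d) + v\<^sup>2 * (a' * d') + u * v * (a * d' + a' * d)"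
    by (intro add_mono mult_left_mono ge cross) (use uv in auto)
  also have "\<dots> = (u * a + v * a') * (u * d + v * d')"
    by (simp add: power2_eq_square algebra_simps)
  finally have "1 \<le> det (u *\<^sub>R X + v *\<^sub>R Y)"
    using uv sym by (simp add: det_2 a_def b_def d_def a'_def b'_def d'_def power2_eq_square)
  then show "u *\<^sub>R X + v *\<^sub>R Y \<in> pos_forms"
    using nn sym uv by (simp add: pos_forms_def a_def b_def d_def a'_def b'_def d'_def)
qed

lemma det_strictly_concave:
  assumes X: "X \<in> pos_forms" and Y: "Y \<in> pos_forms" and D: "det X = D" "det Y = D"
    and mid: "det ((1/2) *\<^sub>R X + (1/2) *\<^sub>R Y) \<le> D"
  shows "X = Y"
proof -
  define a b d a' b' d' where defs: "a = X$1$1" "b = X$1$2" "d = X$2$2"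
    "a' = Y$1$1" "b' = Y$1$2" "d' = Y$2$2"
  have nn: "0 \<le> a" "0 \<le> a'" and sym: "X$2$1 = b" "Y$2$1 = b'" and D1: "1 \<le> D"
    using X Y D by (auto simp: pos_forms_def defs)
  have det: "a * d = D + b\<^sup>2" "a' * d' = D + b'\<^sup>2"
    using D sym by (auto simp: det_2 defs power2_eq_square)
  have "a * d > 0" "a' * d' > 0"
    using det D1 zero_le_power2[of b] zero_le_power2[of b'] by linarith+
  then have pos: "0 < a" "0 < a'" using nn by (simp_all add: zero_less_mult_iff)
  have "(a + a') * (d + d') - (b + b')\<^sup>2 \<le> 4 * D"
    using mid sym by (simp add: det_2 defs power2_eq_square algebra_simps)
  then have cross: "a * d' + a' * d - 2 * b * b' - 2 * D \<le> 0"
    using det by (simp add: power2_eq_square algebra_simps)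
  \<comment> \<open>By the two determinant relations, this sum of squares is a positive multiple of
    a quantity that \<open>mid\<close> makes nonpositive, so both squares vanish.\<close>
  have "D * (a - a')\<^sup>2 + (a * b' - a' * b)\<^sup>2 = (a * a') * (a * d' + a' * d - 2 * b * b' - 2 * D)"
    using det by algebra
  also have "\<dots> \<le> 0" using cross pos by (simp add: mult_nonneg_nonpos)
  finally have "D * (a - a')\<^sup>2 = 0 \<and> (a * b' - a' * b)\<^sup>2 = 0"
    using D1 by (smt (verit) mult_nonneg_nonneg zero_le_power2)
  then have "a = a'" "b = b'" using D1 pos by auto
  moreover from this have "d = d'" using det pos by (metis less_irrefl mult_left_cancel)
  ultimately show ?thesis using sym by (simp add: vec_eq_iff forall_2 defs)
qed

lemma cholesky:
  assumes "Q \<in> pos_forms"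
  obtains M :: mat2 where "invertible M" "transpose M ** M = Q"
proof -
  define a b d D where defs: "a = Q$1$1" "b = Q$1$2" "d = Q$2$2" "D = det Q"
  have *: "0 \<le> a" "Q$2$1 = b" "1 \<le> D" "a * d = D + b\<^sup>2"
    using assms by (auto simp: pos_forms_def defs det_2 power2_eq_square)
  have "a * d > 0" using * zero_le_power2[of b] by linarith
  then have a: "0 < a" using *(1) by (simp add: zero_less_mult_iff)
  define M :: mat2 where "M = vector [vector [sqrt a, b / sqrt a], vector [0, sqrt (D / a)]]"
  have ent: "M$1$1 = sqrt a" "M$1$2 = b / sqrt a" "M$2$1 = 0" "M$2$2 = sqrt (D / a)"
    by (simp_all add: M_def)
  have "det M \<noteq> 0" using a * by (simp add: det_2 ent)
  then have "invertible M" by (simp add: invertible_det_nz)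
  have "b / sqrt a * (b / sqrt a) + sqrt (D / a) * sqrt (D / a) = (b\<^sup>2 + D) / a"
    using a * by (simp add: power2_eq_square add_divide_distrib)
  also have "\<dots> = d" using a *(4) by (simp add: nonzero_divide_eq_eq mult.commute)
  finally have "transpose M ** M = Q"
    using a * by (simp add: vec_eq_iff forall_2 sum_2 matrix_matrix_mult_def transpose_def ent) (simp add: defs)
  with \<open>invertible M\<close> show ?thesis using that by blast
qed

lemma component_le_opnorm: "\<bar>A $ i $ j\<bar> \<le> opnorm A"
  using component_le_onorm[of "(*v) A" i j] unfolding opnorm_def by simp

lemma norm_mat2_le: "norm (X::mat2) \<le> (\<Sum>i\<in>UNIV. \<Sum>j\<in>UNIV. \<bar>X$i$j\<bar>)"
proof -
  have "norm X \<le> (\<Sum>i\<in>UNIV. norm (X$i))" unfolding norm_vec_def by (rule L2_set_le_sum) simp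
  also have "\<dots> \<le> (\<Sum>i\<in>UNIV. \<Sum>j\<in>UNIV. \<bar>X$i$j\<bar>)" by (intro sum_mono norm_le_l1_cart)
  finally show ?thesis .
qed

text \<open>The forms \<open>A\<^sup>T A\<close>, for normalised \<open>A\<close> in the semigroup, span a bounded convex set that every
  generator maps into itself without changing determinants. The point of largest determinant is
  unique, hence it is an invariant inner product.\<close>
lemma bounded_imp_strongly_conformal:
  assumes inv: "\<forall>A\<in>AA. invertible A"
    and bd: "\<And>A. A \<in> gen_semigroup AA \<Longrightarrow> opnorm A \<le> c * sqrt \<bar>det A\<bar>"
  shows "strongly_conformal AA"
proof (cases "AA = {}")
  case True
  then show ?thesis unfolding strongly_conformal_def by (auto intro!: exI[of _ "mat 1"] simp: invertible_det_nz)
next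
  case False
  define K0 where "K0 = (\<lambda>A. transpose (unimod A) ** unimod A) ` gen_semigroup AA"
  define K where "K = closure (convex hull K0)"
  have ginv: "invertible A" if "A \<in> gen_semigroup AA" for A
    using gen_semigroup_invertible[OF inv that] .
  have "K0 \<subseteq> pos_forms"
  proof
    fix X assume "X \<in> K0"
    then obtain A where A: "A \<in> gen_semigroup AA" "X = transpose (unimod A) ** unimod A"
      unfolding K0_def by blast
    have "det X = 1" using det_unimod[OF ginv[OF A(1)]] by (simp add: A(2) det_mul power2_eq_square)
    then show "X \<in> pos_forms"
      by (auto simp: pos_forms_def A(2) matrix_matrix_mult_def transpose_def sum_2 mult.commute)
  qed
  \<comment> \<open>Determinants stay at least one on the closed convex hull, so the maximiser
    \<open>Q\<close> will be positive definite.\<close>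
  then have K_pos: "K \<subseteq> pos_forms"
    unfolding K_def by (intro closure_minimal hull_minimal closed_pos_forms convex_pos_forms)
  have "bounded K0"
  proof (rule boundedI)
    fix X assume "X \<in> K0"
    then obtain A where A: "A \<in> gen_semigroup AA" "X = transpose (unimod A) ** unimod A"
      unfolding K0_def by blast
    have nz: "\<bar>det A\<bar> > 0" using ginv[OF A(1)] by (simp add: invertible_det_nz)
    then have "\<bar>det A\<bar> powr (-1/2) * sqrt \<bar>det A\<bar> = 1"
      by (simp add: powr_minus powr_half_sqrt)
    then have "opnorm (unimod A) \<le> c"
      using mult_left_mono[OF bd[OF A(1)], of "\<bar>det A\<bar> powr (-1/2)"] by (simp add: unimod_def mult_ac)
    then have e: "\<bar>unimod A $ i $ j\<bar> \<le> c" for i j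
      using component_le_opnorm order_trans by blast
    then have e2: "\<bar>unimod A $ i $ j * unimod A $ k $ l\<bar> \<le> c * c" for i j k l
      unfolding abs_mult by (intro mult_mono) (auto intro: order_trans[OF abs_ge_zero e])
    have "\<bar>X $ i $ j\<bar> \<le> 2 * (c * c)" for i j
      using e2[of 1 i 1 j] e2[of 2 i 2 j] unfolding A(2) matrix_matrix_mult_def transpose_def
      by (simp add: sum_2)
    then have "(\<Sum>i\<in>UNIV. \<Sum>j\<in>UNIV. \<bar>X$i$j\<bar>) \<le> (\<Sum>i\<in>(UNIV::2 set). \<Sum>j\<in>(UNIV::2 set). 2 * (c * c))"
      by (intro sum_mono)
    then show "norm X \<le> (\<Sum>i\<in>(UNIV::2 set). \<Sum>j\<in>(UNIV::2 set). 2 * (c * c))"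
      using norm_mat2_le order_trans by blast
  qed
  then have "compact K"
    unfolding K_def compact_closure by (rule bounded_convex_hull)
  moreover have "K \<noteq> {}"
    using False gen_semigroup_base unfolding K_def K0_def by auto
  moreover have "continuous_on K det"
    unfolding det_2[abs_def] by (intro continuous_intros)
  ultimately obtain Q where Q: "Q \<in> K" "\<And>X. X \<in> K \<Longrightarrow> det X \<le> det Q"
    using continuous_attains_sup[of K det] by blast
  have invariant: "transpose (unimod B) ** Q ** unimod B = Q" if B: "B \<in> AA" for B
  proof -
    \<comment> \<open>\<open>f\<close> replaces the form of \<open>A\<close> by the form of
      \<open>A ** B\<close>, so it maps \<open>K0\<close> into itself; being linear, it then does
      the same with the closed convex hull.\<close>
    define f where "f X = transpose (unimod B) ** X ** unimod B" for X
    have lin: "linear f"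
      by (rule linearI) (simp_all add: f_def mat2_simps algebra_simps)
    have "f ` K0 \<subseteq> K0"
    proof clarify
      fix X assume "X \<in> K0"
      then obtain A where A: "A \<in> gen_semigroup AA" "X = transpose (unimod A) ** unimod A"
        unfolding K0_def by blast
      have "f X = transpose (unimod (A ** B)) ** unimod (A ** B)"
        by (simp add: f_def A(2) unimod_mult matrix_transpose_mul matrix_mul_assoc)
      then show "f X \<in> K0"
        unfolding K0_def using gen_semigroup_mult[OF A(1) gen_semigroup_base[OF B]] by blast
    qed
    then have "f ` (convex hull K0) \<subseteq> convex hull K0"
      unfolding convex_hull_linear_image[OF lin] by (rule hull_mono)
    moreover have "f ` K \<subseteq> closure (f ` (convex hull K0))"
      unfolding K_def by (rule closure_linear_image_subset[OF lin])
    ultimately have "f ` K \<subseteq> K" unfolding K_def by (meson closure_mono order_trans)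
    then have fQ: "f Q \<in> K" using Q(1) by blast
    have "det (f Q) = det Q"
      using det_unimod[of B] inv B by (simp add: f_def det_mul power2_eq_square)
    moreover have "convex K" unfolding K_def by (simp add: convex_closure)
    \<comment> \<open>The determinant at the midpoint cannot exceed the maximum
      \<open>det Q\<close>, which equals \<open>det (f Q)\<close>; strict concavity makes the two
      forms agree.\<close>
    then have "(1/2) *\<^sub>R f Q + (1/2) *\<^sub>R Q \<in> K"
      using fQ Q(1) by (intro convexD) auto
    ultimately have "f Q = Q"
      using det_strictly_concave[of "f Q" Q "det Q"] K_pos fQ Q by blast
    then show ?thesis by (simp add: f_def)
  qed
  obtain M :: mat2 where M: "invertible M" "transpose M ** M = Q"
    using cholesky K_pos Q(1) by blast
  define W where "W = matrix_inv M"
  have MW: "M ** W = mat 1" using M by (simp add: W_def matrix_inv_inverse)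
  have WM: "transpose W ** transpose M = mat 1"
    using arg_cong[OF MW, of transpose] by (simp add: matrix_transpose_mul)
  \<comment> \<open>Conjugation by \<open>M\<close> turns the invariant form
    \<open>transpose M ** M\<close> into the standard one.\<close>
  have "orthogonal_matrix ((\<bar>det A\<bar> powr (-1/2)) *\<^sub>R (M ** A ** W))" if A: "A \<in> AA" for A
  proof -
    have "(r *\<^sub>R (M ** A ** W)) = M ** (r *\<^sub>R A) ** W" for r
      by (simp add: mat2_simps algebra_simps)
    then have Y: "(\<bar>det A\<bar> powr (-1/2)) *\<^sub>R (M ** A ** W) = M ** unimod A ** W"
      unfolding unimod_def .
    have "transpose (M ** unimod A ** W) ** (M ** unimod A ** W)
      = transpose W ** (transpose (unimod A) ** (transpose M ** M) ** unimod A) ** W"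
      by (simp add: matrix_transpose_mul matrix_mul_assoc)
    also have "\<dots> = (transpose W ** transpose M) ** (M ** W)"
      unfolding M(2) invariant[OF A] unfolding M(2)[symmetric] by (simp add: matrix_mul_assoc)
    also have "\<dots> = mat 1" unfolding MW WM by simp
    finally show ?thesis unfolding Y orthogonal_matrix .
  qed
  then show ?thesis unfolding strongly_conformal_def W_def using M(1) by blast
qed

section \<open>Almost multiplicative semigroups\<close>

locale am_semigroup =
  fixes AA :: "mat2 set" and \<kappa> :: real
  assumes kappa: "0 < \<kappa>" "\<kappa> \<le> 1"
    and inv: "\<And>A. A \<in> AA \<Longrightarrow> invertible A"
    and am: "\<And>A B. A \<in> gen_semigroup AA \<Longrightarrow> B \<in> gen_semigroup AA \<Longrightarrow>
               \<kappa> * opnorm A * opnorm B \<le> opnorm (A ** B)"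
begin

abbreviation "S \<equiv> gen_semigroup AA"

text \<open>This is the set \<open>T\<close> above. The free scalars let renormalised powers of a
  single matrix converge to a singular matrix.\<close>

definition limits :: "mat2 set" where
  "limits = closure {r *\<^sub>R A | r A. A \<in> S}"

lemma limits_sequence:
  assumes "P \<in> limits"
  obtains r A where "\<And>n. A n \<in> S" "(\<lambda>n::nat. r n *\<^sub>R A n) \<longlonglongrightarrow> P"
proof -
  obtain M where M: "\<And>n. M n \<in> {r *\<^sub>R A | r A. A \<in> S}" "M \<longlonglongrightarrow> P"
    using assms unfolding limits_def closure_sequential by blast
  have "\<forall>n. \<exists>r A. M n = r *\<^sub>R A \<and> A \<in> S" using M(1) by blast
  then obtain r A where "\<And>n. M n = r n *\<^sub>R A n" "\<And>n. A n \<in> S" by metis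
  moreover from this have "M = (\<lambda>n. r n *\<^sub>R A n)" by blast
  ultimately show ?thesis using that[of A r] M(2) by blast
qed

lemma limitsI:
  assumes "\<And>n. A n \<in> S" "(\<lambda>n::nat. r n *\<^sub>R A n) \<longlonglongrightarrow> P"
  shows "P \<in> limits"
  unfolding limits_def closure_sequential using assms by (intro exI[of _ "\<lambda>n. r n *\<^sub>R A n"]) blast

lemma limits_base: "A \<in> S \<Longrightarrow> A \<in> limits"
  using limitsI[of "\<lambda>_. A" "\<lambda>_. 1" A] by simp

text \<open>The inequality is homogeneous in each factor and continuous, so it survives scaling and
  limits.\<close>

lemma limits_mult_am:
  assumes "P \<in> limits" "Q \<in> limits"
  shows limits_mult: "P ** Q \<in> limits"
    and limits_am: "\<kappa> * opnorm P * opnorm Q \<le> opnorm (P ** Q)"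
proof -
  obtain r A where A: "\<And>n. A n \<in> S" "(\<lambda>n::nat. r n *\<^sub>R A n) \<longlonglongrightarrow> P"
    using limits_sequence[OF assms(1)] by blast
  obtain s B where B: "\<And>n. B n \<in> S" "(\<lambda>n::nat. s n *\<^sub>R B n) \<longlonglongrightarrow> Q"
    using limits_sequence[OF assms(2)] by blast
  have lim: "(\<lambda>n. (r n * s n) *\<^sub>R (A n ** B n)) \<longlonglongrightarrow> P ** Q"
    using tendsto_matrix_mult[OF A(2) B(2)] by (simp add: scaleR_mult_scaleR)
  then show "P ** Q \<in> limits" by (rule limitsI[rotated]) (intro gen_semigroup_mult A B)
  have "\<kappa> * opnorm (r n *\<^sub>R A n) * opnorm (s n *\<^sub>R B n) \<le> opnorm ((r n * s n) *\<^sub>R (A n ** B n))" for n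
    using mult_left_mono[OF am[OF A(1) B(1), of n n], of "\<bar>r n\<bar> * \<bar>s n\<bar>"] by (simp add: abs_mult mult_ac)
  then show "\<kappa> * opnorm P * opnorm Q \<le> opnorm (P ** Q)"
    by (intro LIMSEQ_le[OF tendsto_mult[OF tendsto_mult[OF tendsto_const tendsto_opnorm[OF A(2)]] tendsto_opnorm[OF B(2)]] tendsto_opnorm[OF lim]]) blast
qed

text \<open>Powers of \<open>A\<close>, divided by those of the leading eigenvalue, tend to the
  projection onto the unstable line along the stable line; \<open>outer p w\<close> is this
  projection.\<close>

lemma proximal_limit:
  assumes "A \<in> S" "proximal A"
  obtains p q w where "outer p w \<in> limits" "p \<noteq> 0" "q \<noteq> 0" "w \<noteq> 0" "w \<bullet> q = 0"
    "u_space A = span {p}" "s_space A = span {q}"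
proof -
  obtain l m p q where A: "A *v p = l *\<^sub>R p" "A *v q = m *\<^sub>R q" "p \<noteq> 0" "q \<noteq> 0" "\<bar>m\<bar> < \<bar>l\<bar>"
    using proximalE[OF assms(2)] .
  define W where "W = wedge p q"
  have W: "W \<noteq> 0" using eigenvectors_independent[OF A(1-4)] A(5) by (auto simp: W_def)
  \<comment> \<open>Pairing with \<open>w\<close> is \<open>wedge x q / W\<close>, which is one at
    \<open>p\<close> and zero at \<open>q\<close>.\<close>
  define w :: vec2 where "w = vector [q$2 / W, - q$1 / W]"
  define P where "P = outer p w"
  have wx: "w \<bullet> x = wedge x q / W" for x
    by (simp add: w_def inner_vec_def sum_2 wedge_def diff_divide_distrib mult.commute)
  have wp: "w \<bullet> p = 1" and wq: "w \<bullet> q = 0" using W by (simp_all add: wx W_def) (simp add: wedge_def)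
  have dec: "x = (w \<bullet> x) *\<^sub>R p + (wedge p x / W) *\<^sub>R q" for x
    using wedge_decomposition[of p q x] W by (simp add: wx W_def)
  \<comment> \<open>\<open>pow n\<close> is the power \<open>n + 1\<close> of \<open>A\<close>,
    since the identity need not lie in the semigroup.\<close>
  define pow where "pow n = ((**) A ^^ n) A" for n
  have pow_S: "pow n \<in> S" for n
    by (induction n) (auto simp: pow_def assms(1) gen_semigroup_mult)
  have pow_eq: "pow n *v x = (l ^ Suc n * (w \<bullet> x)) *\<^sub>R p + (m ^ Suc n * (wedge p x / W)) *\<^sub>R q" for n x
  proof (induction n)
    case 0
    show ?case using arg_cong[OF dec[of x], of "(*v) A"]
      by (simp add: pow_def matrix_vector_right_distrib matrix_vector_mult_scaleR A mult.commute)
  next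
    case (Suc n)
    have "pow (Suc n) *v x = A *v (pow n *v x)" by (simp add: pow_def matrix_vector_mul_assoc)
    then show ?case unfolding Suc.IH
      by (simp add: matrix_vector_right_distrib matrix_vector_mult_scaleR A mult_ac)
  qed
  have l0: "l \<noteq> 0" using A(5) by auto
  \<comment> \<open>The complementary projection, onto the stable line; its coefficient
    \<open>(m / l) ^ Suc n\<close> tends to zero.\<close>
  define R where "R = mat 1 - P"
  have "(inverse l ^ Suc n *\<^sub>R pow n) *v x = (P + (m / l) ^ Suc n *\<^sub>R R) *v x" for n x
  proof -
    have "R *v x = (wedge p x / W) *\<^sub>R q"
      using dec[of x] by (simp add: R_def P_def matrix_vector_mult_diff_rdistrib outer_mult_vec algebra_simps)
    moreover have "inverse l ^ Suc n * (l ^ Suc n * a) = a" for a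
      using l0 by (simp add: power_inverse flip: mult.assoc del: power_Suc)
    moreover have "inverse l ^ Suc n * (m ^ Suc n * a) = (m / l) ^ Suc n * a" for a
      using l0 by (simp only: divide_inverse power_mult_distrib mult_ac)
    ultimately show ?thesis
      unfolding matrix_vector_mult_add_rdistrib scaleR_matrix_vector_assoc[symmetric] pow_eq P_def outer_mult_vec scaleR_add_right scaleR_scaleR
      by (simp only: scaleR_scaleR)
  qed
  then have "inverse l ^ Suc n *\<^sub>R pow n = P + (m / l) ^ Suc n *\<^sub>R R" for n
    unfolding matrix_eq by blast
  moreover have "(\<lambda>n. P + (m / l) ^ Suc n *\<^sub>R R) \<longlonglongrightarrow> P + 0 *\<^sub>R R"
    using A(5) by (intro tendsto_intros LIMSEQ_Suc LIMSEQ_power_zero) (simp add: l0)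
  ultimately have "P \<in> limits"
    by (intro limitsI[of pow "\<lambda>n. inverse l ^ Suc n"] pow_S) simp
  moreover have "w \<noteq> 0" using wp by auto
  ultimately show ?thesis
    using that[of p w q] A wq proximal_eigenspaces[OF A] unfolding P_def by blast
qed

text \<open>With trace zero the square would vanish, against \<open>limits_am\<close>.\<close>

lemma outer_limit_trace:
  assumes "outer v w \<in> limits" "v \<noteq> 0" "w \<noteq> 0"
  shows "w \<bullet> v \<noteq> 0"
proof
  assume "w \<bullet> v = 0"
  then have "\<kappa> * opnorm (outer v w) * opnorm (outer v w) \<le> 0"
    using limits_am[OF assms(1) assms(1)] by (simp add: outer_mult_outer)
  moreover have "opnorm (outer v w) > 0" using assms by (simp add: opnorm_outer)
  ultimately show False using kappa by (simp add: mult_le_0_iff)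
qed

definition "U_lines = {u_space A | A. A \<in> S \<and> proximal A}"
definition "S_lines = {s_space A | A. A \<in> S \<and> proximal A}"

lemma X_u_eq: "X_u AA = RP1_top closure_of U_lines" and X_s_eq: "X_s AA = RP1_top closure_of S_lines"
  by (simp_all add: X_u_def X_s_def U_lines_def S_lines_def)

text \<open>A matrix close to a rank one matrix of nonzero trace is proximal, and by Cayley--Hamilton the
  range of \<open>A - m\<close>, for its smaller eigenvalue \<open>m\<close>, is its unstable line.\<close>
lemma outer_limit_in_X_u:
  assumes lim: "outer v w \<in> limits" and v: "v \<noteq> 0" and w: "w \<noteq> 0" and vt: "v = r0 *\<^sub>R dir t"
  shows "line_of_angle t \<in> X_u AA"
proof -
  define P where "P = outer v w"
  define T where "T = w \<bullet> v"
  have T: "T \<noteq> 0" using outer_limit_trace[OF lim v w] by (simp add: T_def)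
  obtain r A where A: "\<And>n. A n \<in> S" "(\<lambda>n::nat. r n *\<^sub>R A n) \<longlonglongrightarrow> P"
    using limits_sequence[OF lim[folded P_def]] by blast
  define M where "M n = r n *\<^sub>R A n" for n
  have M: "M \<longlonglongrightarrow> P" using A(2) unfolding M_def .
  have tr: "(\<lambda>n. trace (M n)) \<longlonglongrightarrow> T"
  proof -
    have "(\<lambda>n. trace (M n)) \<longlonglongrightarrow> trace P"
      unfolding trace_def by (intro tendsto_intros M)
    then show ?thesis by (simp add: P_def trace_outer T_def)
  qed
  have dt: "(\<lambda>n. det (M n)) \<longlonglongrightarrow> 0"
  proof -
    have "(\<lambda>n. det (M n)) \<longlonglongrightarrow> det P"
      unfolding det_2 by (intro tendsto_intros M)
    then show ?thesis by (simp add: P_def det_outer)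
  qed
  define D where "D n = (trace (M n))\<^sup>2 - 4 * det (M n)" for n
  have D: "D \<longlonglongrightarrow> T\<^sup>2"
  proof -
    have "D \<longlonglongrightarrow> T\<^sup>2 - 4 * 0" unfolding D_def by (intro tendsto_intros tr dt)
    then show ?thesis by simp
  qed
  \<comment> \<open>The factor \<open>sgn T\<close> orders the roots so that, for either sign of
    \<open>T\<close>, \<open>m n\<close> tends to zero and \<open>l n\<close> to
    \<open>T\<close>.\<close>
  define m where "m n = (trace (M n) - sgn T * sqrt (D n)) / 2" for n
  define l where "l n = (trace (M n) + sgn T * sqrt (D n)) / 2" for n
  have sT: "sgn T * sqrt (T\<^sup>2) = T" by (simp add: sgn_mult_abs)
  have m0: "m \<longlonglongrightarrow> 0"
  proof -
    have "m \<longlonglongrightarrow> (T - sgn T * sqrt (T\<^sup>2)) / 2" unfolding m_def by (intro tendsto_intros tr D) simp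
    then show ?thesis by (simp only: sT) simp
  qed
  have lT: "l \<longlonglongrightarrow> T"
  proof -
    have "l \<longlonglongrightarrow> (T + sgn T * sqrt (T\<^sup>2)) / 2" unfolding l_def by (intro tendsto_intros tr D) simp
    then show ?thesis by (simp only: sT) simp
  qed
  \<comment> \<open>\<open>z n\<close> lies in the range of \<open>M n - m n\<close>, and it tends
    to the nonzero vector \<open>T *\<^sub>R v\<close>.\<close>
  define z where "z n = M n *v v - m n *\<^sub>R v" for n
  have z: "z \<longlonglongrightarrow> (T * r0) *\<^sub>R dir t"
  proof -
    have "z \<longlonglongrightarrow> P *v v - 0 *\<^sub>R v"
      unfolding z_def by (intro tendsto_intros tendsto_matrix_vector_mult M m0)
    then show ?thesis unfolding P_def outer_mult_vec T_def[symmetric] by (simp add: vt)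
  qed
  have Tr: "T * r0 \<noteq> 0" using T v vt by auto
  have "\<forall>\<^sub>F n in sequentially. D n > 0"
    using D T by (intro order_tendstoD(1)) auto
  moreover have "\<forall>\<^sub>F n in sequentially. \<bar>m n\<bar> < \<bar>T\<bar> / 2"
    using tendsto_rabs[OF m0] T by (intro order_tendstoD(2)) auto
  moreover have "\<forall>\<^sub>F n in sequentially. \<bar>T\<bar> / 2 < \<bar>l n\<bar>"
    using tendsto_rabs[OF lT] T by (intro order_tendstoD(1)) auto
  moreover have "\<forall>\<^sub>F n in sequentially. z n \<noteq> 0"
    using tendsto_imp_eventually_ne[OF z] Tr by simp
  ultimately have "\<forall>\<^sub>F n in sequentially. span {z n} \<in> U_lines"
  proof eventually_elim
    case (elim n)
    have "sgn T * sgn T = 1" using T by (simp add: sgn_if)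
    then have sq: "(sgn T * sqrt (D n)) * (sgn T * sqrt (D n)) = D n"
      using elim(1) by (simp add: algebra_simps)
    define x where "x = sgn T * sqrt (D n)"
    have ml: "m n = (trace (M n) - x) / 2" "l n = (trace (M n) + x) / 2"
      by (simp_all add: m_def l_def x_def)
    have sum: "m n + l n = trace (M n)" by (simp add: ml field_simps)
    have "m n * l n = ((trace (M n))\<^sup>2 - x * x) / 4"
      by (simp add: ml field_simps power2_eq_square)
    then have prod: "m n * l n = det (M n)"
      using sq by (simp add: x_def D_def)
    obtain q where q: "q \<noteq> 0" "M n *v q = m n *\<^sub>R q" using eigenvector_exists[OF sum prod] by blast
    have zl: "M n *v z n = l n *\<^sub>R z n"
    proof -
      have "M n *v (M n *v v) = (m n + l n) *\<^sub>R (M n *v v) - (m n * l n) *\<^sub>R v"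
        unfolding sum prod matrix_vector_mul_assoc cayley_hamilton_2
        by (simp add: matrix_vector_mult_diff_rdistrib flip: scaleR_matrix_vector_assoc)
      then show ?thesis
        by (simp add: z_def matrix_vector_mult_diff_distrib matrix_vector_mult_scaleR algebra_simps)
    qed
    have r: "r n \<noteq> 0"
    proof
      assume "r n = 0"
      then have "z n = - m n *\<^sub>R v" "l n *\<^sub>R z n = 0" using zl by (simp_all add: z_def M_def)
      then show False using elim by auto
    qed
    have "A n *v x = (k / r n) *\<^sub>R x" if "M n *v x = k *\<^sub>R x" for x k
    proof -
      have "r n *\<^sub>R (A n *v x) = k *\<^sub>R x" using that by (simp add: M_def scaleR_matrix_vector_assoc)
      then have "inverse (r n) *\<^sub>R (r n *\<^sub>R (A n *v x)) = inverse (r n) *\<^sub>R k *\<^sub>R x" by simp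
      then show ?thesis using r by (simp add: divide_inverse mult.commute)
    qed
    from this[OF zl] this[OF q(2)] have "proximal (A n)" "u_space (A n) = span {z n}"
      using proximal_eigenspaces[of "A n" "z n" "l n / r n" q "m n / r n"] elim q r
      by (auto simp: abs_divide divide_strict_right_mono)
    then show ?case unfolding U_lines_def using A(1) by blast
  qed
  then show ?thesis unfolding X_u_eq by (rule line_in_closure_of[OF z Tr])
qed

text \<open>If \<open>outer p w\<close> is the limit attached to a proximal element, then
  \<open>outer (A *v p) w\<close> is again in \<open>limits\<close>, so the line of
  \<open>A *v p\<close> lies in \<open>X_u\<close>. Approximation extends this to the
  closure.\<close>

lemma X_u_invariant:
  assumes t: "line_of_angle t \<in> X_u AA" and A: "A \<in> S" and s: "A *v dir t = r *\<^sub>R dir s" and r: "r \<noteq> 0"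
  shows "line_of_angle s \<in> X_u AA"
proof -
  have "\<exists>s. \<bar>t - s\<bar> < inverse (real (Suc n)) \<and> line_of_angle s \<in> U_lines" for n :: nat
    by (rule closure_of_RP1_near[OF t[unfolded X_u_eq]]) simp
  then obtain f where f: "\<And>n. \<bar>t - f n\<bar> < inverse (real (Suc n))" "\<And>n. line_of_angle (f n) \<in> U_lines"
    by metis
  have "(\<lambda>n. dir (f n) - dir t) \<longlonglongrightarrow> 0"
  proof (rule Lim_null_comparison[OF _ LIMSEQ_inverse_real_of_nat])
    show "\<forall>\<^sub>F n in sequentially. norm (dir (f n) - dir t) \<le> inverse (real (Suc n))"
    proof (intro always_eventually allI)
      show "norm (dir (f n) - dir t) \<le> inverse (real (Suc n))" for n
        using norm_dir_diff_le[of "f n" t] f(1)[of n] by linarith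
    qed
  qed
  then have "(\<lambda>n. dir (f n)) \<longlonglongrightarrow> dir t" by (rule LIM_zero_cancel)
  then have lim: "(\<lambda>n. A *v dir (f n)) \<longlonglongrightarrow> r *\<^sub>R dir s"
    using tendsto_matrix_vector_mult[OF tendsto_const, of "\<lambda>n. dir (f n)" "dir t" sequentially A] s by simp
  have "span {A *v dir (f n)} \<in> X_u AA" for n
  proof -
    obtain B where B: "B \<in> S" "proximal B" "line_of_angle (f n) = u_space B" using f(2)[of n] unfolding U_lines_def by blast
    obtain p q w where pq: "outer p w \<in> limits" "p \<noteq> 0" "w \<noteq> 0" "u_space B = span {p}"
      using proximal_limit[OF B(1,2)] by metis
    have "p \<in> span {dir (f n)}" using B pq by (metis line_of_angle_dir singletonI span_base)
    then obtain k where k: "p = k *\<^sub>R dir (f n)" by (auto simp: span_singleton)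
    have Ap: "outer (A *v p) w \<in> limits"
      using limits_mult[OF limits_base[OF A] pq(1)] by (simp add: mult_outer)
    have "A *v p \<noteq> 0"
      using gen_semigroup_invertible[OF _ A] inv pq(2) invertible_left_inverse[of A] matrix_left_invertible_ker[of A] by blast
    then obtain u c where u: "c \<noteq> 0" "A *v p = c *\<^sub>R dir u" by (metis polar)
    have "k \<noteq> 0" using k pq by auto
    then have "span {A *v dir (f n)} = span {A *v p}"
      unfolding k matrix_vector_mult_scaleR by (simp add: span_scaleR)
    also have "\<dots> = line_of_angle u" unfolding u(2) line_of_angle_dir by (rule span_scaleR[OF u(1)])
    finally show ?thesis using outer_limit_in_X_u[OF Ap \<open>A *v p \<noteq> 0\<close> pq(3) u(2)] by simp
  qed
  then have "line_of_angle s \<in> RP1_top closure_of X_u AA"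
    by (intro line_in_closure_of[OF lim r]) simp
  then show ?thesis by (simp add: X_u_eq)
qed

section \<open>An invariant cone around the unstable lines\<close>

definition expanded :: "real \<Rightarrow> vec2 set" where
  "expanded \<epsilon> = {x. \<forall>B\<in>limits. \<epsilon> * opnorm B * norm x \<le> norm (B *v x)}"

text \<open>Test \<open>x\<close> against the product \<open>B ** A\<close>; passing from the norm
  of the product to the product of the norms costs one factor \<kappa>.\<close>

lemma expanded_image:
  assumes x: "x \<in> expanded \<epsilon>" and e: "0 \<le> \<epsilon>" and A: "A \<in> limits"
  shows "A *v x \<in> expanded (\<epsilon> * \<kappa>)"
  unfolding expanded_def
proof (intro CollectI ballI)
  fix B assume B: "B \<in> limits"
  have "\<epsilon> * \<kappa> * opnorm B * norm (A *v x) \<le> \<epsilon> * \<kappa> * opnorm B * (opnorm A * norm x)"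
    using e kappa by (intro mult_left_mono opnorm_bound) auto
  also have "\<dots> = \<epsilon> * (\<kappa> * opnorm B * opnorm A) * norm x" by simp
  also have "\<dots> \<le> \<epsilon> * opnorm (B ** A) * norm x"
    using e by (intro mult_left_mono mult_right_mono limits_am B A) auto
  also have "\<dots> \<le> norm ((B ** A) *v x)"
    using x limits_mult[OF B A] by (auto simp: expanded_def)
  finally show "\<epsilon> * \<kappa> * opnorm B * norm (A *v x) \<le> norm (B *v (A *v x))"
    by (simp add: matrix_vector_mul_assoc)
qed

lemma expanded_mono: "\<epsilon> \<le> \<delta> \<Longrightarrow> expanded \<delta> \<subseteq> expanded \<epsilon>"
proof
  fix x assume le: "\<epsilon> \<le> \<delta>" and x: "x \<in> expanded \<delta>"
  have "\<epsilon> * opnorm B * norm x \<le> \<delta> * opnorm B * norm x" for B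
    using le by (intro mult_right_mono) auto
  then show "x \<in> expanded \<epsilon>"
    using x unfolding expanded_def by (blast intro: order_trans)
qed

lemma expanded_scaleR: "x \<in> expanded \<epsilon> \<Longrightarrow> r *\<^sub>R x \<in> expanded \<epsilon>"
  unfolding expanded_def
  by (auto simp: matrix_vector_mult_scaleR mult.left_commute intro!: mult_left_mono)

lemma closed_expanded: "closed (expanded \<epsilon>)"
proof -
  have "expanded \<epsilon> = (\<Inter>B\<in>limits. {x. \<epsilon> * opnorm B * norm x \<le> norm (B *v x)})"
    by (auto simp: expanded_def)
  moreover have "continuous_on UNIV (\<lambda>x. B *v x)" for B :: mat2
    by (rule linear_continuous_on[OF matrix_vector_mul_bounded_linear])
  then have "closed {x. \<epsilon> * opnorm B * norm x \<le> norm (B *v x)}" for B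
    by (intro closed_Collect_le continuous_on_norm continuous_on_mult continuous_on_const continuous_on_id)
  ultimately show ?thesis by auto
qed

text \<open>The largest invariant subset of \<open>expanded (\<kappa>\<^sup>2 / 2)\<close>. The unstable lines lie in \<open>expanded \<kappa>\<close>, so
  the loss of a factor \<open>\<kappa>\<close> under the action leaves room for a neighbourhood of them.\<close>
definition cone :: "vec2 set" where
  "cone = {x \<in> expanded (\<kappa>\<^sup>2 / 2). \<forall>A\<in>limits. A *v x \<in> expanded (\<kappa>\<^sup>2 / 2)}"

lemma cone_invariant: "A \<in> limits \<Longrightarrow> x \<in> cone \<Longrightarrow> A *v x \<in> cone"
  unfolding cone_def by (auto simp: matrix_vector_mul_assoc limits_mult)

lemma cone_scaleR: "x \<in> cone \<Longrightarrow> r *\<^sub>R x \<in> cone"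
  unfolding cone_def by (auto simp: matrix_vector_mult_scaleR expanded_scaleR)

lemma cone_scaleR_iff: "r \<noteq> 0 \<Longrightarrow> r *\<^sub>R x \<in> cone \<longleftrightarrow> x \<in> cone"
  using cone_scaleR[of "r *\<^sub>R x" "inverse r"] cone_scaleR[of x r] by auto

lemma closed_cone: "closed cone"
proof -
  have "cone = expanded (\<kappa>\<^sup>2 / 2) \<inter> (\<Inter>A\<in>limits. (\<lambda>x. A *v x) -` expanded (\<kappa>\<^sup>2 / 2))"
    by (auto simp: cone_def)
  moreover have "closed ((\<lambda>x. A *v x) -` expanded (\<kappa>\<^sup>2 / 2))" for A :: mat2
    by (rule continuous_closed_vimage[OF closed_expanded])
      (rule linear_continuous_at[OF matrix_vector_mul_bounded_linear])
  ultimately show ?thesis using closed_expanded by (metis closed_INT closed_Int)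
qed

text \<open>From \<open>\<kappa> / 2\<close>, one application of an element of \<open>limits\<close>
  costs a factor \<kappa> and lands exactly at \<open>\<kappa>\<^sup>2 / 2\<close>.\<close>

lemma expanded_subset_cone: "expanded (\<kappa> / 2) \<subseteq> cone"
proof -
  have "\<kappa>\<^sup>2 / 2 \<le> \<kappa> / 2" using kappa by (simp add: power2_eq_square mult_left_le)
  then have "expanded (\<kappa> / 2) \<subseteq> expanded (\<kappa>\<^sup>2 / 2)" by (rule expanded_mono)
  then show ?thesis
    using expanded_image[of _ "\<kappa> / 2"] kappa unfolding cone_def by (auto simp: power2_eq_square)
qed

text \<open>Almost multiplicativity for \<open>B ** outer p w\<close> puts unstable directions into
  \<open>expanded \<kappa>\<close>. A change of direction by at most \<open>\<kappa> / 2\<close>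
  loses at most half of that constant.\<close>

lemma X_u_neighbourhood:
  assumes t: "line_of_angle t \<in> X_u AA" and s: "\<bar>t - s\<bar> < \<kappa> / 2"
  shows "dir s \<in> cone"
proof -
  \<comment> \<open>With this margin an unstable line within \<open>e\<close> of \<open>t\<close> is
    still within \<open>\<kappa> / 2\<close> of \<open>s\<close>.\<close>
  define e where "e = \<kappa> / 2 - \<bar>t - s\<bar>"
  have "e > 0" using s by (simp add: e_def)
  from closure_of_RP1_near[OF t[unfolded X_u_eq] this]
  obtain t' where t': "\<bar>t - t'\<bar> < e" "line_of_angle t' \<in> U_lines" by blast
  obtain A where A: "A \<in> S" "proximal A" "line_of_angle t' = u_space A" using t'(2) unfolding U_lines_def by blast
  obtain p q w where pq: "outer p w \<in> limits" "p \<noteq> 0" "w \<noteq> 0" "u_space A = span {p}"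
    using proximal_limit[OF A(1,2)] by metis
  have "p \<in> span {dir t'}" using A pq by (metis line_of_angle_dir singletonI span_base)
  then obtain k where k: "p = k *\<^sub>R dir t'" by (auto simp: span_singleton)
  have "dir s \<in> expanded (\<kappa> / 2)"
    unfolding expanded_def
  proof (intro CollectI ballI)
    fix B assume B: "B \<in> limits"
    have "\<kappa> * opnorm B * (norm p * norm w) \<le> norm (B *v p) * norm w"
      using limits_am[OF B pq(1)] by (simp add: mult_outer opnorm_outer)
    then have "\<kappa> * opnorm B * norm p \<le> norm (B *v p)"
      using pq(3) by (simp add: mult.assoc[symmetric])
    moreover have "k \<noteq> 0" using k pq by auto
    ultimately have 1: "\<kappa> * opnorm B \<le> norm (B *v dir t')"
      unfolding k by (simp add: matrix_vector_mult_scaleR mult.commute)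
    have "norm (B *v (dir t' - dir s)) \<le> opnorm B * norm (dir t' - dir s)" by (rule opnorm_bound)
    also have "\<dots> \<le> opnorm B * (\<kappa> / 2)"
      using norm_dir_diff_le[of t' s] t'(1) by (intro mult_left_mono) (auto simp: e_def)
    finally have "norm (B *v dir t') - norm (B *v dir s) \<le> opnorm B * (\<kappa> / 2)"
      using norm_triangle_ineq2[of "B *v dir t'" "B *v dir s"] by (simp add: matrix_vector_mult_diff_distrib)
    then show "\<kappa> / 2 * opnorm B * norm (dir s) \<le> norm (B *v dir s)"
      using 1 by (simp add: mult.commute)
  qed
  then show ?thesis using expanded_subset_cone by blast
qed

text \<open>The nonzero matrix \<open>outer p w\<close> kills the stable line, so it shrinks nearby
  directions more than membership in \<open>cone\<close> permits.\<close>

lemma X_s_disjoint: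
  assumes "line_of_angle t \<in> X_s AA"
  shows "dir t \<notin> cone"
proof
  assume c: "dir t \<in> cone"
  have pos: "\<kappa>\<^sup>2 / 2 > 0" using kappa by simp
  from closure_of_RP1_near[OF assms[unfolded X_s_eq] pos]
  obtain t' where t': "\<bar>t - t'\<bar> < \<kappa>\<^sup>2 / 2" "line_of_angle t' \<in> S_lines" by blast
  obtain A where A: "A \<in> S" "proximal A" "line_of_angle t' = s_space A" using t'(2) unfolding S_lines_def by blast
  obtain p q w where pq: "outer p w \<in> limits" "p \<noteq> 0" "w \<noteq> 0" "w \<bullet> q = 0" "s_space A = span {q}"
    using proximal_limit[OF A(1,2)] by metis
  have "dir t' \<in> span {q}" using A pq by (metis line_of_angle_dir singletonI span_base)
  then have "w \<bullet> dir t' = 0" using pq(4) by (auto simp: span_singleton)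
  then have "outer p w *v dir t = outer p w *v (dir t - dir t')"
    by (simp add: outer_mult_vec inner_diff_right)
  then have "norm (outer p w *v dir t) \<le> opnorm (outer p w) * norm (dir t - dir t')"
    using opnorm_bound by metis
  moreover have "\<kappa>\<^sup>2 / 2 * opnorm (outer p w) \<le> norm (outer p w *v dir t)"
    using c pq(1) unfolding cone_def expanded_def by force
  ultimately have "\<kappa>\<^sup>2 / 2 * opnorm (outer p w) \<le> norm (dir t - dir t') * opnorm (outer p w)"
    by (simp add: mult.commute)
  then have "\<kappa>\<^sup>2 / 2 \<le> norm (dir t - dir t')"
    by (rule mult_right_le_imp_le) (use pq in \<open>simp add: opnorm_outer\<close>)
  then show False using norm_dir_diff_le[of t t'] t'(1) by simp
qed

text \<open>If \<open>A\<close> is parabolic with eigenvalue \<open>l\<close>, then \<open>A\<^sup>n / (n l\<^sup>n\<^sup>-\<^sup>1)\<close> tends to the nilpotent \<open>A - l\<close>.\<close>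
lemma not_parabolic:
  assumes A: "A \<in> S"
  shows "\<not> parabolic A"
proof
  assume "parabolic A"
  then obtain l where ev: "real_eigenvalue A l" and uniq: "\<And>m. real_eigenvalue A m \<Longrightarrow> m = l"
    and dim: "dim (eigenspace A l) = 1"
    unfolding parabolic_def by blast
  obtain p where p: "p \<noteq> 0" "A *v p = l *\<^sub>R p" using ev unfolding real_eigenvalue_def by blast
  have "A *v (A *v p) = trace A *\<^sub>R (A *v p) - det A *\<^sub>R p"
    unfolding matrix_vector_mul_assoc cayley_hamilton_2
    by (simp add: matrix_vector_mult_diff_rdistrib flip: scaleR_matrix_vector_assoc)
  then have "(l * l - trace A * l + det A) *\<^sub>R p = 0"
    by (simp add: p(2) matrix_vector_mult_scaleR algebra_simps)
  then have char: "l * l - trace A * l + det A = 0" using p(1) by simp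
  \<comment> \<open>The other root of the characteristic polynomial is an eigenvalue too, so
    uniqueness makes \<open>l\<close> a double root.\<close>
  define m where "m = trace A - l"
  have lm: "m + l = trace A" "m * l = det A"
    using char by (simp_all add: m_def algebra_simps)
  then have "m = l" using uniq eigenvector_exists[OF lm] unfolding real_eigenvalue_def by blast
  then have tr: "trace A = 2 * l" and dt: "det A = l * l" using lm by auto
  have l0: "l \<noteq> 0"
    using gen_semigroup_invertible[OF _ A] inv dt by (auto simp: invertible_det_nz)
  define N where "N = A - l *\<^sub>R mat 1"
  have AN: "A = l *\<^sub>R mat 1 + N" by (simp add: N_def)
  have step: "(l *\<^sub>R mat 1 + N) ** (a *\<^sub>R mat 1 + b *\<^sub>R N) = (l * a) *\<^sub>R mat 1 + (a + l * b) *\<^sub>R N + b *\<^sub>R (N ** N)" for a b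
    by (simp add: mat2_simps algebra_simps)
  have "N ** N = A ** A - (2 * l) *\<^sub>R A + (l * l) *\<^sub>R mat 1"
    by (simp add: N_def mat2_simps algebra_simps)
  then have NN: "N ** N = 0" by (simp add: cayley_hamilton_2 tr dt)
  have "N \<noteq> 0"
  proof
    assume "N = 0"
    then have "A *v v = l *\<^sub>R v" for v using AN by (simp flip: scaleR_matrix_vector_assoc)
    then have "eigenspace A l = UNIV" by (simp add: eigenspace_def)
    then show False using dim by simp
  qed
  \<comment> \<open>Again the power \<open>n + 1\<close>. As \<open>N ** N = 0\<close>, its binomial
    expansion has only two terms.\<close>
  define pow where "pow n = ((**) A ^^ n) A" for n
  have pow_S: "pow n \<in> S" for n
    by (induction n) (auto simp: pow_def A gen_semigroup_mult)
  have pow_eq: "pow n = l ^ Suc n *\<^sub>R mat 1 + (real (Suc n) * l ^ n) *\<^sub>R N" for n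
  proof (induction n)
    case (Suc n)
    have "pow (Suc n) = (l *\<^sub>R mat 1 + N) ** pow n" by (simp add: pow_def flip: AN)
    also have "\<dots> = (l * l ^ Suc n) *\<^sub>R mat 1 + (l ^ Suc n + l * (real (Suc n) * l ^ n)) *\<^sub>R N"
      unfolding Suc.IH step NN by simp
    also have "l ^ Suc n + l * (real (Suc n) * l ^ n) = real (Suc (Suc n)) * l ^ Suc n"
      by (simp add: algebra_simps)
    finally show ?case by simp
  qed (simp add: pow_def flip: AN)
  have "inverse (real (Suc n) * l ^ n) *\<^sub>R pow n = (l * inverse (real (Suc n))) *\<^sub>R mat 1 + N" for n
  proof -
    have nz: "real (Suc n) * l ^ n \<noteq> 0" using l0 by simp
    then have eq: "inverse (real (Suc n) * l ^ n) * l ^ Suc n = l * inverse (real (Suc n))"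
      using l0 by (simp add: divide_simps)
    show ?thesis
      unfolding pow_eq scaleR_add_right scaleR_scaleR by (simp only: eq left_inverse[OF nz] scaleR_one)
  qed
  moreover have "(\<lambda>n. (l * inverse (real (Suc n))) *\<^sub>R mat 1 + N) \<longlonglongrightarrow> (l * 0) *\<^sub>R mat 1 + N"
    by (intro tendsto_intros LIMSEQ_inverse_real_of_nat)
  ultimately have "N \<in> limits"
    by (intro limitsI[of pow "\<lambda>n. inverse (real (Suc n) * l ^ n)"] pow_S) simp
  then have "\<kappa> * opnorm N * opnorm N \<le> 0" using limits_am[of N N] NN by simp
  moreover have "opnorm N > 0" using \<open>N \<noteq> 0\<close> by (simp add: opnorm_pos_iff)
  ultimately show False using kappa by (simp add: mult_le_0_iff)
qed

section \<open>Construction of the multicone\<close>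

lemma exists_unstable_multicone:
  assumes "\<exists>A\<in>S. proximal A"
  shows "\<exists>C. invariant_multicone AA C \<and> unstable_multicone AA C"
proof -
  obtain A0 where A0: "A0 \<in> S" "proximal A0" using assms by blast
  obtain p q where p: "p \<noteq> 0" "u_space A0 = span {p}" and q: "q \<noteq> 0" "s_space A0 = span {q}"
    using proximal_limit[OF A0] by metis
  \<comment> \<open>The projective line is cut at a stable line. Its angle is outside the cone, so
    no component of cone angles crosses the cut, and the window from \<open>\<sigma>\<close> to
    \<open>\<sigma> + pi\<close> serves as a chart.\<close>
  obtain \<sigma> c where "c \<noteq> 0" "q = c *\<^sub>R dir \<sigma>" by (metis polar[OF q(1)])
  then have "line_of_angle \<sigma> = s_space A0" using q span_scaleR by (simp add: line_of_angle_dir)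
  then have "line_of_angle \<sigma> \<in> S_lines" using A0 unfolding S_lines_def by blast
  then have \<sigma>: "line_of_angle \<sigma> \<in> X_s AA"
    unfolding X_s_eq using closure_of_subset_Int[of RP1_top S_lines] by auto
  obtain \<tau> d where \<tau>: "\<sigma> \<le> \<tau>" "\<tau> < \<sigma> + pi" "d \<noteq> 0" "p = d *\<^sub>R dir \<tau>"
    using polar[OF p(1), of \<sigma>] by blast
  then have "line_of_angle \<tau> = u_space A0" using p span_scaleR by (simp add: line_of_angle_dir)
  then have "line_of_angle \<tau> \<in> U_lines" using A0 unfolding U_lines_def by blast
  then have \<tau>_u: "line_of_angle \<tau> \<in> X_u AA"
    unfolding X_u_eq using closure_of_subset_Int[of RP1_top U_lines] by auto

  define F where "F = {t. dir t \<in> cone}"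
  define \<delta> where "\<delta> = \<kappa> / 2"
  have \<delta>: "\<delta> > 0" using kappa by (simp add: \<delta>_def)
  have closed_F: "closed F"
    unfolding F_def vimage_def[symmetric]
    by (rule continuous_closed_vimage[OF closed_cone])
      (use continuous_on_dir[of UNIV] in \<open>simp add: continuous_on_eq_continuous_at\<close>)
  have line_F: "s \<in> F \<longleftrightarrow> t \<in> F" if st: "line_of_angle s = line_of_angle t" for s t
  proof -
    have "dir s \<in> span {dir t}" using st by (metis line_of_angle_dir singletonI span_base)
    then obtain k where k: "dir s = k *\<^sub>R dir t" by (auto simp: span_singleton)
    then have "k \<noteq> 0" using dir_nonzero[of s] by auto
    then show ?thesis unfolding F_def mem_Collect_eq k by (rule cone_scaleR_iff)
  qed
  have X_s_F: "t \<notin> F" if "line_of_angle t \<in> X_s AA" for t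
    using X_s_disjoint[OF that] by (simp add: F_def)
  have \<sigma>F: "\<sigma> \<notin> F" "\<sigma> + pi \<notin> F"
    using X_s_F[OF \<sigma>] line_F[of "\<sigma> + pi" \<sigma>] by (auto simp: line_of_angle_eq_iff)
  define J where "J = {t. \<sigma> \<le> t \<and> t < \<sigma> + pi \<and> line_of_angle t \<in> X_u AA}"
  have \<tau>J: "\<tau> \<in> J" using \<tau> \<tau>_u by (simp add: J_def)
  have ball_F: "ball t \<delta> \<subseteq> F" if "t \<in> J" for t
    using X_u_neighbourhood that by (auto simp: J_def F_def \<delta>_def dist_real_def)
  define comp where "comp t = connected_component_set F t" for t
  have comp_conn: "connected (comp t)" and comp_F: "comp t \<subseteq> F" for t
    by (simp_all add: comp_def connected_component_subset)
  have comp_ball: "ball t \<delta> \<subseteq> comp t" if "t \<in> J" for t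
    unfolding comp_def using ball_F[OF that] \<delta> by (intro connected_component_maximal) auto
  have comp_refl: "t \<in> comp t" if "t \<in> J" for t
    using comp_ball[OF that] \<delta> by auto
  \<comment> \<open>A component leaving the window would, being an interval, contain
    \<open>\<sigma>\<close> or \<open>\<sigma> + pi\<close>, neither of which is in
    \<open>F\<close>.\<close>
  have comp_range: "\<sigma> < y \<and> y < \<sigma> + pi" if t: "t \<in> J" and y: "y \<in> comp t" for t y
  proof (rule ccontr)
    assume "\<not> ?thesis"
    then consider "y \<le> \<sigma>" | "\<sigma> + pi \<le> y" by linarith
    then show False
    proof cases
      case 1
      then have "\<sigma> \<in> comp t"
        using connectedD_interval[OF comp_conn y comp_refl[OF t], of \<sigma>] t by (auto simp: J_def)
      then show ?thesis using comp_F \<sigma>F by blast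
    next
      case 2
      then have "\<sigma> + pi \<in> comp t"
        using connectedD_interval[OF comp_conn comp_refl[OF t] y, of "\<sigma> + pi"] t by (auto simp: J_def)
      then show ?thesis using comp_F \<sigma>F by blast
    qed
  qed
  have comp_interval: "closed_proj_interval (line_of_angle ` comp t)" if t: "t \<in> J" for t
  proof -
    have "comp t \<subseteq> {\<sigma>..\<sigma> + pi}" using comp_range[OF t] by (auto simp: less_imp_le)
    then have "bounded (comp t)" using bounded_closed_interval bounded_subset by blast
    moreover have "closed (comp t)" unfolding comp_def by (rule closed_connected_component[OF closed_F])
    ultimately have "compact (comp t)" by (simp add: compact_eq_bounded_closed)
    then obtain a b where ab: "comp t = {a..b}"
      using comp_conn connected_compact_interval_1 by metis
    then have "a \<le> b" using comp_refl[OF t] by auto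
    then have "a \<in> comp t" "b \<in> comp t" using ab by auto
    then have "b < a + pi" using comp_range[OF t, of a] comp_range[OF t, of b] by linarith
    then show ?thesis unfolding closed_proj_interval_def using ab \<open>a \<le> b\<close> by blast
  qed
  define C where "C = (\<Union>t\<in>J. line_of_angle ` comp t)"
  have C_F: "t \<in> F" if "line_of_angle t \<in> C" for t
  proof -
    obtain s where "s \<in> F" "line_of_angle t = line_of_angle s"
      using \<open>line_of_angle t \<in> C\<close> comp_F unfolding C_def by blast
    then show ?thesis using line_F by blast
  qed
  have C_RP1: "C \<subseteq> RP1" unfolding C_def by auto
  have "finite (comp ` J)"
  proof -
    \<comment> \<open>Points of \<open>J\<close> in the same cell of length \<open>\<delta>\<close>
      share a component, and finitely many cells meet the window.\<close>
    define g where "g t = \<lfloor>t / \<delta>\<rfloor>" for t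
    have eq: "comp s = comp t" if "s \<in> J" "t \<in> J" "g s = g t" for s t
    proof -
      have "of_int (g s) \<le> s / \<delta>" "s / \<delta> < of_int (g s) + 1" "of_int (g t) \<le> t / \<delta>" "t / \<delta> < of_int (g t) + 1"
        by (simp_all add: g_def)
      then have "\<bar>s / \<delta> - t / \<delta>\<bar> < 1" using that(3) by linarith
      then have "\<bar>s - t\<bar> / \<delta> < 1" using \<delta> by (simp add: diff_divide_distrib[symmetric])
      then have "t \<in> ball s \<delta>" using \<delta> by (simp add: dist_real_def)
      then have "t \<in> comp s" using comp_ball[OF that(1)] by blast
      then show ?thesis unfolding comp_def by (rule connected_component_eq[symmetric])
    qed
    have "g ` J \<subseteq> {\<lfloor>\<sigma> / \<delta>\<rfloor>..\<lfloor>(\<sigma> + pi) / \<delta>\<rfloor>}"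
      using \<delta> by (auto simp: g_def J_def intro!: floor_mono divide_right_mono)
    then have fin: "finite (g ` J)" using finite_subset by blast
    have "comp ` J \<subseteq> (\<lambda>k. comp (inv_into J g k)) ` (g ` J)"
    proof clarify
      fix t assume t: "t \<in> J"
      have "comp t = comp (inv_into J g (g t))"
        using t by (intro eq inv_into_into f_inv_into_f[symmetric]) auto
      then show "comp t \<in> (\<lambda>k. comp (inv_into J g k)) ` (g ` J)" using t by blast
    qed
    then show ?thesis using fin finite_surj by blast
  qed
  then have "finite ((`) line_of_angle ` (comp ` J))" by (rule finite_imageI)
  moreover have "C = \<Union> ((`) line_of_angle ` (comp ` J))" unfolding C_def by blast
  moreover have "\<forall>I \<in> (`) line_of_angle ` (comp ` J). closed_proj_interval I"
    using comp_interval by blast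
  moreover have "line_of_angle \<sigma> \<notin> C" using C_F \<sigma>F by blast
  then have "C \<noteq> RP1" using line_of_angle_in_RP1 by blast
  moreover have "C \<noteq> {}" unfolding C_def using \<tau>J comp_refl by blast
  ultimately have mc: "multicone C" unfolding multicone_def using C_RP1 by blast
  have inside: "x \<in> RP1_top interior_of C" if x: "x \<in> X_u AA" for x
  proof -
    have "x \<in> RP1" using x closure_of_subset_topspace[of RP1_top] unfolding X_u_def by auto
    then obtain t where t: "\<sigma> \<le> t" "t < \<sigma> + pi" "x = line_of_angle t" by (rule RP1_angle)
    then have tJ: "t \<in> J" using x by (simp add: J_def)
    have "line_of_angle ` ball t \<delta> \<subseteq> C" unfolding C_def using comp_ball[OF tJ] tJ by blast
    then have "line_of_angle ` ball t \<delta> \<subseteq> RP1_top interior_of C"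
      by (intro interior_of_maximal openin_line_image open_ball)
    then show ?thesis using t \<delta> by auto
  qed

  \<comment> \<open>The image of a component is followed as a connected set \<open>K\<close> of
    nonzero plane vectors, so no continuous choice of image angles is needed. It meets the unstable
    line at \<open>t'\<close>, and it remains to join \<open>t'\<close> to \<open>\<theta>'\<close>
    inside \<open>F\<close>.\<close>
  have "act A L \<in> C" if A: "A \<in> AA" and L: "L \<in> C" for A L
  proof -
    obtain t \<theta> where t: "t \<in> J" "\<theta> \<in> comp t" "L = line_of_angle \<theta>" using L unfolding C_def by blast
    have AS: "A \<in> S" using A by (rule gen_semigroup_base)
    have nz: "A *v dir s \<noteq> 0" for s
      using inv[OF A] invertible_left_inverse[of A] matrix_left_invertible_ker[of A] dir_nonzero by blast
    have in_cone: "A *v dir s \<in> cone" if "s \<in> comp t" for s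
      using cone_invariant[OF limits_base[OF AS]] that comp_F by (auto simp: F_def)
    define K where "K = (\<lambda>s. A *v dir s) ` comp t"
    have "continuous_on (comp t) (\<lambda>s. A *v dir s)"
      by (rule continuous_on_compose2[OF linear_continuous_on[OF matrix_vector_mul_bounded_linear] continuous_on_dir subset_UNIV])
    then have K: "connected K" unfolding K_def using comp_conn by (rule connected_continuous_image)
    have K_F: "s \<in> F" if xK: "x \<in> K" and xs: "x \<in> line_of_angle s" for x s
    proof -
      obtain k where k: "x = k *\<^sub>R dir s" using xs by (auto simp: line_of_angle_dir span_singleton)
      have "x \<noteq> 0" "x \<in> cone" using xK nz in_cone unfolding K_def by auto
      then show ?thesis using k cone_scaleR_iff[of k "dir s"] by (auto simp: F_def)
    qed
    obtain t' r' where t': "\<sigma> \<le> t'" "t' < \<sigma> + pi" "r' \<noteq> 0" "A *v dir t = r' *\<^sub>R dir t'"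
      using polar[OF nz[of t], of \<sigma>] by blast
    obtain \<theta>' r where \<theta>': "\<sigma> \<le> \<theta>'" "\<theta>' < \<sigma> + pi" "r \<noteq> 0" "A *v dir \<theta> = r *\<^sub>R dir \<theta>'"
      using polar[OF nz[of \<theta>], of \<sigma>] by blast
    have mem: "r' *\<^sub>R dir t' \<in> K" "r *\<^sub>R dir \<theta>' \<in> K"
      using t(2) comp_refl[OF t(1)] t'(4) \<theta>'(4) unfolding K_def by (metis image_eqI)+
    then have F': "t' \<in> F" "\<theta>' \<in> F"
      using K_F unfolding line_of_angle_dir span_singleton by blast+
    have lt: "\<sigma> < t'" "\<sigma> < \<theta>'" using F' \<sigma>F t'(1) \<theta>'(1) by (auto simp: less_le)
    have "line_of_angle t' \<in> X_u AA"
      using X_u_invariant[OF _ AS t'(4,3)] t(1) by (simp add: J_def)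
    then have t'J: "t' \<in> J" using t' by (simp add: J_def)
    \<comment> \<open>For \<open>c\<close> strictly between the two angles, the lines at
      \<open>\<sigma>\<close> and \<open>c\<close> separate the two image vectors. So
      \<open>K\<close> meets one of them; it cannot be the first, hence \<open>c\<close> is in
      \<open>F\<close>.\<close>
    have seg: "closed_segment t' \<theta>' \<subseteq> F"
    proof
      fix c assume c: "c \<in> closed_segment t' \<theta>'"
      consider "c = t'" | "c = \<theta>'" | "t' < c" "c < \<theta>'" | "\<theta>' < c" "c < t'"
        using c by (fastforce simp: closed_segment_eq_real_ivl less_le split: if_splits)
      then show "c \<in> F"
      proof cases
        case 3
        have "\<exists>x\<in>K. x \<in> line_of_angle \<sigma> \<or> x \<in> line_of_angle c"
          using connected_meets_line[OF K mem t'(3) \<theta>'(3) lt(1) 3 \<theta>'(2)] .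
        then show ?thesis using K_F \<sigma>F by blast
      next
        case 4
        have "\<exists>x\<in>K. x \<in> line_of_angle \<sigma> \<or> x \<in> line_of_angle c"
          using connected_meets_line[OF K mem(2,1) \<theta>'(3) t'(3) lt(2) 4 t'(2)] .
        then show ?thesis using K_F \<sigma>F by blast
      qed (use F' in auto)
    qed
    have "closed_segment t' \<theta>' \<subseteq> comp t'"
      unfolding comp_def using seg by (intro connected_component_maximal) auto
    then have "\<theta>' \<in> comp t'" by auto
    moreover have "act A L = line_of_angle \<theta>'"
      using \<theta>' span_scaleR by (simp add: t(3) line_of_angle_dir act_span)
    ultimately show ?thesis unfolding C_def using t'J by blast
  qed
  then have invC: "invariant_multicone AA C" unfolding invariant_multicone_def using mc by blast
  have "C \<inter> X_s AA = {}"
  proof -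
    have "x \<notin> X_s AA" if x: "x \<in> C" for x
    proof -
      obtain t where "x = line_of_angle t" using x unfolding C_def by blast
      then show ?thesis using C_F x X_s_F by blast
    qed
    then show ?thesis by blast
  qed
  moreover have "RP1_top frontier_of C \<inter> X_u AA = {}"
    using inside by (auto simp: frontier_of_def)
  moreover have "K \<inter> X_u AA \<noteq> {}" if K: "K \<in> connected_components_of (subtopology RP1_top C)" for K
  proof -
    obtain x where x: "x \<in> K" using nonempty_connected_components_of[OF K] by blast
    have "K \<subseteq> C" using connected_components_of_subset[OF K] by auto
    then obtain t \<theta> where t: "t \<in> J" "\<theta> \<in> comp t" "x = line_of_angle \<theta>" using x unfolding C_def by blast
    \<comment> \<open>The arc of \<open>C\<close> through \<open>x\<close> is connected, so
      \<open>K\<close> contains all of it, including the unstable line at \<open>t\<close>.\<close>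
    have "connectedin RP1_top (line_of_angle ` comp t)"
      using connectedin_continuous_map_image[OF continuous_map_line_of_angle] comp_conn by auto
    then have "connectedin (subtopology RP1_top C) (line_of_angle ` comp t)"
      unfolding connectedin_subtopology using t(1) C_def by blast
    then have "line_of_angle ` comp t \<subseteq> K"
      using connected_components_of_maximal[OF K] x t by (auto simp: disjnt_iff)
    then have "line_of_angle t \<in> K" using comp_refl[OF t(1)] by blast
    then show ?thesis using t(1) by (auto simp: J_def)
  qed
  ultimately have "unstable_multicone AA C"
    unfolding unstable_multicone_def using mc assms by blast
  then show ?thesis using invC by blast
qed

end

text \<open>That exactly one condition holds is expressed by equivalence of the first with the
  negation of the second.\<close>

theorem theorem2p1:
  fixes AA :: "(real^2^2) set"
  assumes "\<forall>A\<in>AA. invertible A"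
    and "almost_multiplicative (gen_semigroup AA)"
  shows "strongly_conformal AA \<longleftrightarrow>
           \<not> ((\<exists>C. invariant_multicone AA C \<and> unstable_multicone AA C)
              \<and> (\<forall>A\<in>gen_semigroup AA. \<not> parabolic A))"
proof
  assume "strongly_conformal AA"
  \<comment> \<open>An unstable multicone comes with a proximal element, which strong conformality
    excludes.\<close>
  then have "\<not> unstable_multicone AA C" for C
    using strongly_conformal_not_proximal[OF assms(1)] unfolding unstable_multicone_def by blast
  then show "\<not> ((\<exists>C. invariant_multicone AA C \<and> unstable_multicone AA C)
              \<and> (\<forall>A\<in>gen_semigroup AA. \<not> parabolic A))" by blast
next
  assume neg: "\<not> ((\<exists>C. invariant_multicone AA C \<and> unstable_multicone AA C)
              \<and> (\<forall>A\<in>gen_semigroup AA. \<not> parabolic A))"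
  obtain k where k: "k > 0"
    "\<And>A B. A \<in> gen_semigroup AA \<Longrightarrow> B \<in> gen_semigroup AA \<Longrightarrow> k * opnorm A * opnorm B \<le> opnorm (A ** B)"
    using assms(2) unfolding almost_multiplicative_def by blast
  define \<kappa> where "\<kappa> = min k 1"
  have \<kappa>: "0 < \<kappa>" "\<kappa> \<le> 1" using k(1) by (auto simp: \<kappa>_def)
  have am: "\<kappa> * opnorm A * opnorm B \<le> opnorm (A ** B)"
    if "A \<in> gen_semigroup AA" "B \<in> gen_semigroup AA" for A B
  proof -
    have "\<kappa> * (opnorm A * opnorm B) \<le> k * (opnorm A * opnorm B)"
      by (intro mult_right_mono) (auto simp: \<kappa>_def)
    then show ?thesis using k(2)[OF that] by (simp add: mult.assoc)
  qed
  interpret am_semigroup AA \<kappa>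
    using \<kappa> am assms(1) by unfold_locales auto
  \<comment> \<open>Parabolic elements never occur here, so failure of the second condition means
    that there is no multicone, hence no proximal element.\<close>
  have "\<forall>A\<in>gen_semigroup AA. \<not> proximal A"
    using neg exists_unstable_multicone not_parabolic by blast
  then have "opnorm A \<le> 3 / \<kappa> * sqrt \<bar>det A\<bar>" if "A \<in> gen_semigroup AA" for A
    using not_proximal_opnorm_le[OF \<kappa> am[OF that that]] that by blast
  then show "strongly_conformal AA" by (rule bounded_imp_strongly_conformal[OF assms(1)])
qed

end
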